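(* Let $G$ be a topological group. (i) Let $1\to A\xrightarrow{\iota} B\xrightarrow{\pi} C\to 1$ be a short exact sequence of topological $G$-modules and continuous $G$-homomorphisms, where $\iota$ is a homeomorphic embedding. Then $$0\to H^{0}(G,A)\xrightarrow{\iota_0^*}H^{0}(G,B)\xrightarrow{\pi_0^*}H^{0}(G,C)\xrightarrow{\delta^0}H^{1}(G,A)\xrightarrow{\iota_1^*}H^{1}(G,B)\xrightarrow{\pi_1^*}H^{1}(G,C)$$ is an exact sequence of pointed sets. (ii) If in addition $\iota(A)\subset Z(B)$ (the center of $B$) and $\pi$ has a continuous section $s:C\to B$ (a continuous map with $\pi s=\mathrm{Id}_C$), then $$0\to H^{0}(G,A)\xrightarrow{\iota_0^*}H^{0}(G,B)\xrightarrow{\pi_0^*}H^{0}(G,C)\xrightarrow{\delta^0}H^{1}(G,A)\xrightarrow{\iota_1^*}H^{1}(G,B)\xrightarrow{\pi_1^*}H^{1}(G,C)\xrightarrow{\delta^1}H^{2}(G,A)$$ is an exact sequence of pointed sets.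
   Context: Topological groups are arbitrary (not necessarily abelian). A topological $G$-module $A$ is a topological group on which $G$ acts continuously on the left by group automorphisms; the action is written ${}^g a$. A $G$-homomorphism is a group homomorphism commuting with the $G$-actions. $H^0(G,A)=\{a\in A: {}^g a=a\ \forall g\in G\}$, a pointed set with basepoint $1$. A continuous derivation is a continuous map $\alpha:G\to A$ with $\alpha(gh)=\alpha(g)\,{}^g\alpha(h)$ for all $g,h\in G$; the set of these is $Der_c(G,A)$. Two continuous derivations $\alpha,\beta$ are cohomologous ($\alpha\sim\beta$) if there is $a\in A$ with $\beta(g)=a^{-1}\alpha(g)\,{}^g a$ for all $g\in G$. $H^1(G,A)=Der_c(G,A)/\sim$, a pointed set with basepoint the class of the trivial derivation $g\mapsto 1$. For an abelian topological $G$-module $A$, $H^n(G,A)$ is cohomology in the sense of Hu: $\tilde C^0(G,A)=A$; for $n\ge 1$, $\tilde C^n(G,A)$ is the group of continuous maps $G^n\to A$; and (additively) $\tilde\delta^n f(g_1,\dots,g_{n+1})={}^{g_1}f(g_2,\dots,g_{n+1})+\sum_{i=1}^n(-1)^i f(g_1,\dots,g_ig_{i+1},\dots,g_{n+1})+(-1)^{n+1}f(g_1,\dots,g_n)$; $H^n(G,A)=\ker\tilde\delta^n/\operatorname{Im}\tilde\delta^{n-1}$. $H^2(G,A)$ is pointed by its neutral element. For a continuous $G$-homomorphism $f:A\to B$, $f_0^*:H^0(G,A)\to H^0(G,B)$ is the restriction of $f$, and $f_1^*:H^1(G,A)\to H^1(G,B)$ is $[\alpha]\mapsto[f\circ\alpha]$.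 Identify $A$ with $\iota(A)$. The map $\delta^0$ is defined by: for $c\in H^0(G,C)$ choose $b\in B$ with $\pi(b)=c$; $\delta^0(c)$ is the class of the continuous derivation $g\mapsto b^{-1}\,{}^g b\in A$ (independent of $b$). In (ii), $A$ is abelian, and $\delta^1([\alpha])$ is the class in $H^2(G,A)$ of the continuous map $(g,h)\mapsto s\alpha(g)\cdot{}^g(s\alpha(h))\cdot(s\alpha(gh))^{-1}$, which takes values in $A$ (the class is independent of $s$ and of the representative $\alpha$). A sequence $X\xrightarrow{f}Y\xrightarrow{g}Z$ of pointed sets and basepoint-preserving maps is exact if $\operatorname{Im}(f)=\operatorname{Ker}(g)$, where $\operatorname{Ker}(g)$ is the set of points mapped to the basepoint. *)

theory Defs
  imports
    "HOL-Algebra.Bij"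
    "HOL-Algebra.Coset"
    "HOL-Algebra.Elementary_Groups"
    "HOL-Algebra.FiniteProduct"
    "HOL-Analysis.Product_Topology"
    "HOL-Analysis.Function_Topology"
begin

section \<open>Topological groups and topological modules\<close>

record 'a top_group = "'a monoid" +
  topo :: "'a topology"

text \<open>No separation axiom is imposed.\<close>

locale topological_group = group G for G :: "('a, 'm) top_group_scheme" (structure) +
  assumes topspace_topo: "topspace (topo G) = carrier G"
    and continuous_mult:
      "continuous_map (prod_topology (topo G) (topo G)) (topo G) (\<lambda>(x, y). x \<otimes> y)"
    and continuous_inv: "continuous_map (topo G) (topo G) (\<lambda>x. inv x)"

record ('g, 'a) top_module = "'a top_group" +
  act :: "'g \<Rightarrow> 'a \<Rightarrow> 'a"

text \<open>
  A homomorphism from \<open>G\<close> to \<open>AutoGroup A\<close> is a left action of \<open>G\<close> on \<open>A\<close> by group automorphisms.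
  The elements of \<open>AutoGroup A\<close> are extensional functions, so \<open>act A g\<close> is \<open>undefined\<close> outside
  \<open>carrier A\<close> for \<open>g \<in> carrier G\<close>; this only fixes irrelevant values.
\<close>

locale topological_module =
  grp: topological_group G + mdl: topological_group A
  for G :: "'g top_group" and A :: "('g, 'a) top_module" +
  assumes act_hom: "act A \<in> hom G (AutoGroup A)"
    and continuous_act:
      "continuous_map (prod_topology (topo G) (topo A)) (topo A) (\<lambda>(g, a). act A g a)"

definition continuous_G_hom ::
  "'g top_group \<Rightarrow> ('g, 'a) top_module \<Rightarrow> ('g, 'b) top_module \<Rightarrow> ('a \<Rightarrow> 'b) \<Rightarrow> bool"
  where "continuous_G_hom G A B f \<longleftrightarrow>
    f \<in> hom A B \<and> continuous_map (topo A) (topo B) f \<and>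
    (\<forall>g\<in>carrier G. \<forall>a\<in>carrier A. f (act A g a) = act B g (f a))"

definition short_exact_top_modules ::
  "'g top_group \<Rightarrow> ('g, 'a) top_module \<Rightarrow> ('g, 'b) top_module \<Rightarrow> ('g, 'c) top_module \<Rightarrow>
    ('a \<Rightarrow> 'b) \<Rightarrow> ('b \<Rightarrow> 'c) \<Rightarrow> bool"
  where "short_exact_top_modules G A B C \<iota> \<pi> \<longleftrightarrow>
    topological_module G A \<and> topological_module G B \<and> topological_module G C \<and>
    continuous_G_hom G A B \<iota> \<and> continuous_G_hom G B C \<pi> \<and>
    \<iota> \<in> mon A B \<and> \<pi> \<in> epi B C \<and> \<iota> ` carrier A = kernel B C \<pi>"

definition group_center :: "('a, 'm) monoid_scheme \<Rightarrow> 'a set"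
  where "group_center B = {z \<in> carrier B. \<forall>b\<in>carrier B. z \<otimes>\<^bsub>B\<^esub> b = b \<otimes>\<^bsub>B\<^esub> z}"


section \<open>Pointed sets\<close>

type_synonym 'x pointed_set = "'x set \<times> 'x"

definition pointed_map :: "'x pointed_set \<Rightarrow> ('x \<Rightarrow> 'y) \<Rightarrow> 'y pointed_set \<Rightarrow> bool"
  where "pointed_map X f Y \<longleftrightarrow> f ` fst X \<subseteq> fst Y \<and> f (snd X) = snd Y"

definition exact_at ::
  "'x pointed_set \<Rightarrow> ('x \<Rightarrow> 'y) \<Rightarrow> 'y pointed_set \<Rightarrow> ('y \<Rightarrow> 'z) \<Rightarrow> 'z pointed_set \<Rightarrow> bool"
  where "exact_at X f Y g Z \<longleftrightarrow>
    pointed_map X f Y \<and> pointed_map Y g Z \<and> f ` fst X = {y \<in> fst Y. g y = snd Z}"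

definition point :: "unit pointed_set"
  where "point = (UNIV, ())"


section \<open>Nonabelian cohomology in degrees 0 and 1\<close>

definition H0 :: "'g top_group \<Rightarrow> ('g, 'a) top_module \<Rightarrow> 'a pointed_set"
  where "H0 G A = ({a \<in> carrier A. \<forall>g\<in>carrier G. act A g a = a}, \<one>\<^bsub>A\<^esub>)"

definition H0_map :: "'g top_group \<Rightarrow> ('g, 'a) top_module \<Rightarrow> ('a \<Rightarrow> 'b) \<Rightarrow> 'a \<Rightarrow> 'b"
  where "H0_map G A f = restrict f (fst (H0 G A))"

text \<open>
  Maps on \<open>G\<close> (and below on powers of \<open>G\<close>) are represented by extensional functions, so that
  equality of maps is equality of HOL functions.
\<close>

definition Der_c :: "'g top_group \<Rightarrow> ('g, 'a) top_module \<Rightarrow> ('g \<Rightarrow> 'a) set"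
  where "Der_c G A = {\<alpha> \<in> extensional (carrier G).
    continuous_map (topo G) (topo A) \<alpha> \<and>
    (\<forall>g\<in>carrier G. \<forall>h\<in>carrier G. \<alpha> (g \<otimes>\<^bsub>G\<^esub> h) = \<alpha> g \<otimes>\<^bsub>A\<^esub> act A g (\<alpha> h))}"

definition cohomologous ::
  "'g top_group \<Rightarrow> ('g, 'a) top_module \<Rightarrow> (('g \<Rightarrow> 'a) \<times> ('g \<Rightarrow> 'a)) set"
  where "cohomologous G A = {(\<alpha>, \<beta>). \<alpha> \<in> Der_c G A \<and> \<beta> \<in> Der_c G A \<and>
    (\<exists>a\<in>carrier A. \<forall>g\<in>carrier G. \<beta> g = inv\<^bsub>A\<^esub> a \<otimes>\<^bsub>A\<^esub> \<alpha> g \<otimes>\<^bsub>A\<^esub> act A g a)}"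

definition H1_class ::
  "'g top_group \<Rightarrow> ('g, 'a) top_module \<Rightarrow> ('g \<Rightarrow> 'a) \<Rightarrow> ('g \<Rightarrow> 'a) set"
  where "H1_class G A \<alpha> = cohomologous G A `` {\<alpha>}"

definition H1 :: "'g top_group \<Rightarrow> ('g, 'a) top_module \<Rightarrow> ('g \<Rightarrow> 'a) set pointed_set"
  where "H1 G A = (Der_c G A // cohomologous G A, H1_class G A (\<lambda>g\<in>carrier G. \<one>\<^bsub>A\<^esub>))"

text \<open>
  As usual for maps defined through representatives, the union over all choices below is
  the common class when the class does not depend on the choice. If classes of two choices
  differed, their union would not be a single class.
\<close>

definition H1_map ::
  "'g top_group \<Rightarrow> ('g, 'b) top_module \<Rightarrow> ('a \<Rightarrow> 'b) \<Rightarrow> ('g \<Rightarrow> 'a) set \<Rightarrow> ('g \<Rightarrow> 'b) set"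
  where "H1_map G B f X = (\<Union>\<alpha>\<in>X. H1_class G B (\<lambda>g\<in>carrier G. f (\<alpha> g)))"


section \<open>Hu cohomology\<close>

text \<open>
  An element \<open>(g\<^sub>1, \<dots>, g\<^sub>n)\<close> of \<open>G\<^sup>n\<close> is an extensional function on \<open>{1..n}\<close>. The space \<open>G\<^sup>0\<close> is a
  single point, so a 0-cochain amounts to an element of \<open>A\<close>. Everything in this section is meant
  for abelian \<open>A\<close>, written multiplicatively.
\<close>

definition group_power :: "'g top_group \<Rightarrow> nat \<Rightarrow> (nat \<Rightarrow> 'g) set"
  where "group_power G n = {1..n} \<rightarrow>\<^sub>E carrier G"

definition hu_cochains ::
  "'g top_group \<Rightarrow> ('g, 'a) top_module \<Rightarrow> nat \<Rightarrow> ((nat \<Rightarrow> 'g) \<Rightarrow> 'a) monoid"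
  where "hu_cochains G A n =
    \<lparr>carrier = {f \<in> extensional (group_power G n).
        continuous_map (product_topology (\<lambda>_. topo G) {1..n}) (topo A) f},
     mult = (\<lambda>f f'. \<lambda>x\<in>group_power G n. f x \<otimes>\<^bsub>A\<^esub> f' x),
     one = (\<lambda>x\<in>group_power G n. \<one>\<^bsub>A\<^esub>)\<rparr>"

text \<open>\<open>merge_entries G n i\<close> sends \<open>(g\<^sub>1, \<dots>, g\<^sub>n\<^sub>+\<^sub>1)\<close> to \<open>(g\<^sub>1, \<dots>, g\<^sub>i g\<^sub>i\<^sub>+\<^sub>1, \<dots>, g\<^sub>n\<^sub>+\<^sub>1)\<close>.\<close>

definition merge_entries :: "'g top_group \<Rightarrow> nat \<Rightarrow> nat \<Rightarrow> (nat \<Rightarrow> 'g) \<Rightarrow> nat \<Rightarrow> 'g"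
  where "merge_entries G n i x =
    (\<lambda>j\<in>{1..n}. if j < i then x j else if j = i then x i \<otimes>\<^bsub>G\<^esub> x (Suc i) else x (Suc j))"

definition hu_delta ::
  "'g top_group \<Rightarrow> ('g, 'a) top_module \<Rightarrow> nat \<Rightarrow> ((nat \<Rightarrow> 'g) \<Rightarrow> 'a) \<Rightarrow> (nat \<Rightarrow> 'g) \<Rightarrow> 'a"
  where "hu_delta G A n f = (\<lambda>x\<in>group_power G (Suc n).
    act A (x 1) (f (\<lambda>j\<in>{1..n}. x (Suc j)))
    \<otimes>\<^bsub>A\<^esub> finprod A (\<lambda>i. f (merge_entries G n i x) [^]\<^bsub>A\<^esub> ((-1) ^ i :: int)) {1..n}
    \<otimes>\<^bsub>A\<^esub> f (\<lambda>j\<in>{1..n}. x j) [^]\<^bsub>A\<^esub> ((-1) ^ Suc n :: int))"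

definition hu_cocycles ::
  "'g top_group \<Rightarrow> ('g, 'a) top_module \<Rightarrow> nat \<Rightarrow> ((nat \<Rightarrow> 'g) \<Rightarrow> 'a) monoid"
  where "hu_cocycles G A n =
    hu_cochains G A n
      \<lparr>carrier := kernel (hu_cochains G A n) (hu_cochains G A (Suc n)) (hu_delta G A n)\<rparr>"

definition hu_coboundaries ::
  "'g top_group \<Rightarrow> ('g, 'a) top_module \<Rightarrow> nat \<Rightarrow> ((nat \<Rightarrow> 'g) \<Rightarrow> 'a) set"
  where "hu_coboundaries G A n =
    (case n of 0 \<Rightarrow> {\<one>\<^bsub>hu_cochains G A 0\<^esub>}
     | Suc m \<Rightarrow> hu_delta G A m ` carrier (hu_cochains G A m))"

definition hu_cohomology ::
  "'g top_group \<Rightarrow> ('g, 'a) top_module \<Rightarrow> nat \<Rightarrow> ((nat \<Rightarrow> 'g) \<Rightarrow> 'a) set monoid"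
  where "hu_cohomology G A n = hu_cocycles G A n Mod hu_coboundaries G A n"

definition hu_class ::
  "'g top_group \<Rightarrow> ('g, 'a) top_module \<Rightarrow> nat \<Rightarrow> ((nat \<Rightarrow> 'g) \<Rightarrow> 'a) \<Rightarrow> ((nat \<Rightarrow> 'g) \<Rightarrow> 'a) set"
  where "hu_class G A n f = hu_coboundaries G A n #>\<^bsub>hu_cocycles G A n\<^esub> f"

definition H2 :: "'g top_group \<Rightarrow> ('g, 'a) top_module \<Rightarrow> ((nat \<Rightarrow> 'g) \<Rightarrow> 'a) set pointed_set"
  where "H2 G A = (carrier (hu_cohomology G A 2), \<one>\<^bsub>hu_cohomology G A 2\<^esub>)"


section \<open>Connecting maps\<close>

text \<open>\<open>inv_into (carrier A) \<iota>\<close> makes the identification of \<open>\<iota>(A)\<close> with \<open>A\<close> explicit.\<close>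

definition delta0 ::
  "'g top_group \<Rightarrow> ('g, 'a) top_module \<Rightarrow> ('g, 'b) top_module \<Rightarrow> ('a \<Rightarrow> 'b) \<Rightarrow> ('b \<Rightarrow> 'c) \<Rightarrow>
    'c \<Rightarrow> ('g \<Rightarrow> 'a) set"
  where "delta0 G A B \<iota> \<pi> c = (\<Union>b\<in>{b \<in> carrier B. \<pi> b = c}.
    H1_class G A (\<lambda>g\<in>carrier G. inv_into (carrier A) \<iota> (inv\<^bsub>B\<^esub> b \<otimes>\<^bsub>B\<^esub> act B g b)))"

definition delta1 ::
  "'g top_group \<Rightarrow> ('g, 'a) top_module \<Rightarrow> ('g, 'b) top_module \<Rightarrow> ('a \<Rightarrow> 'b) \<Rightarrow> ('c \<Rightarrow> 'b) \<Rightarrow>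
    ('g \<Rightarrow> 'c) set \<Rightarrow> ((nat \<Rightarrow> 'g) \<Rightarrow> 'a) set"
  where "delta1 G A B \<iota> s X = (\<Union>\<alpha>\<in>X. hu_class G A 2 (\<lambda>x\<in>group_power G 2.
    inv_into (carrier A) \<iota>
      (s (\<alpha> (x 1)) \<otimes>\<^bsub>B\<^esub> act B (x 1) (s (\<alpha> (x 2))) \<otimes>\<^bsub>B\<^esub> inv\<^bsub>B\<^esub> (s (\<alpha> (x 1 \<otimes>\<^bsub>G\<^esub> x 2))))))"

end

theory Submission
  imports Defs
begin

text \<open>
  Everything is diagram chasing with explicit elements: a class is changed within its cohomology
  class until it takes values in the kernel of \<open>\<pi>\<close>, and is then pulled back along \<open>\<iota>\<close>. The pull-back
  stays continuous because \<open>\<iota>\<close> is an embedding. In the central case, let \<open>\<alpha>\<close> be a derivation into \<open>C\<close>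
  and \<open>F\<close> the cocycle with \<open>s \<alpha>(g) \<cdot> \<^sup>g(s \<alpha>(h)) = F(g, h) \<cdot> s \<alpha>(gh)\<close>. Any other continuous lift of \<open>\<alpha>\<close>
  or of a cohomologous derivation differs from \<open>s \<alpha>\<close>, up to conjugation, by a continuous \<open>u : G \<rightarrow> A\<close>,
  which multiplies \<open>F\<close> by the coboundary of \<open>u\<close>. Hence \<open>F\<close> is a coboundary exactly when \<open>\<alpha>\<close> lifts to
  a derivation into \<open>B\<close>.
\<close>


section \<open>Cancellation in groups and continuity of pointwise operations\<close>

text \<open>Once \<open>m_assoc\<close> has bracketed products to the right, the plain inverse laws
  no longer match; these rules cancel an inverse pair at the head of a longer product.\<close>

lemma (in group) inv_mult_cancel:
  assumes "x \<in> carrier G" "y \<in> carrier G"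
  shows "inv x \<otimes> (x \<otimes> y) = y" and "x \<otimes> (inv x \<otimes> y) = y"
  using assms by (simp_all flip: m_assoc)

context topological_group
begin

lemma continuous_map_mult:
  assumes "continuous_map X (topo G) f" and "continuous_map X (topo G) f'"
  shows "continuous_map X (topo G) (\<lambda>x. f x \<otimes> f' x)"
  using continuous_map_compose[OF continuous_map_pairedI[OF assms] continuous_mult]
  by (simp add: o_def)

lemma continuous_map_m_inv:
  assumes "continuous_map X (topo G) f"
  shows "continuous_map X (topo G) (\<lambda>x. inv (f x))"
  using continuous_map_compose[OF assms continuous_inv] by (simp add: o_def)

lemma continuous_map_closed:
  assumes "continuous_map X (topo G) f" and "x \<in> topspace X"
  shows "f x \<in> carrier G"
  using continuous_map_image_subset_topspace[OF assms(1)] assms(2) topspace_topo by blast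

end


section \<open>Continuous derivations\<close>

context topological_module
begin

section \<open>The action by automorphisms\<close>

lemma act_in_hom_Bij:
  assumes "g \<in> carrier G"
  shows "act A g \<in> hom A A" and "act A g \<in> Bij (carrier A)"
  using hom_in_carrier[OF act_hom assms] by (simp_all add: AutoGroup_def auto_def)

lemma act_closed [simp]: "\<lbrakk>g \<in> carrier G; a \<in> carrier A\<rbrakk> \<Longrightarrow> act A g a \<in> carrier A"
  by (rule hom_in_carrier[OF act_in_hom_Bij(1)])

lemma act_mult:
  "\<lbrakk>g \<in> carrier G; a \<in> carrier A; b \<in> carrier A\<rbrakk> \<Longrightarrow>
    act A g (a \<otimes>\<^bsub>A\<^esub> b) = act A g a \<otimes>\<^bsub>A\<^esub> act A g b"
  by (rule hom_mult[OF act_in_hom_Bij(1)])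

lemma group_hom_act: "g \<in> carrier G \<Longrightarrow> group_hom A A (act A g)"
  by unfold_locales (rule act_in_hom_Bij(1))

lemma act_one [simp]: "g \<in> carrier G \<Longrightarrow> act A g \<one>\<^bsub>A\<^esub> = \<one>\<^bsub>A\<^esub>"
  by (rule group_hom.hom_one[OF group_hom_act])

lemma act_m_inv:
  "\<lbrakk>g \<in> carrier G; a \<in> carrier A\<rbrakk> \<Longrightarrow> act A g (inv\<^bsub>A\<^esub> a) = inv\<^bsub>A\<^esub> act A g a"
  by (rule group_hom.hom_inv[OF group_hom_act])

text \<open>Multiplicativity of \<open>act A\<close> as a homomorphism into
  \<open>AutoGroup A\<close>, evaluated at a point. The product there is the extensional
  \<open>compose\<close>, hence the evaluation at an element of the carrier.\<close>

lemma act_act: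
  assumes "g \<in> carrier G" "h \<in> carrier G" "a \<in> carrier A"
  shows "act A (g \<otimes>\<^bsub>G\<^esub> h) a = act A g (act A h a)"
proof -
  have "act A (g \<otimes>\<^bsub>G\<^esub> h) = act A g \<otimes>\<^bsub>AutoGroup A\<^esub> act A h"
    using act_hom assms by (simp add: hom_def)
  then show ?thesis
    using assms by (simp add: act_in_hom_Bij(2) AutoGroup_def BijGroup_def compose_def)
qed

lemma continuous_map_act:
  assumes "continuous_map X (topo G) f" and "continuous_map X (topo A) f'"
  shows "continuous_map X (topo A) (\<lambda>x. act A (f x) (f' x))"
  using continuous_map_compose[OF continuous_map_pairedI[OF assms] continuous_act]
  by (simp add: o_def)

lemma continuous_map_const_carrier: "a \<in> carrier A \<Longrightarrow> continuous_map X (topo A) (\<lambda>_. a)"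
  by (simp add: mdl.topspace_topo)

lemmas cont_intros =
  mdl.continuous_map_mult mdl.continuous_map_m_inv continuous_map_act continuous_map_const_carrier
  grp.continuous_map_mult

section \<open>Construction of continuous derivations\<close>

text \<open>Allows a derivation to be given by an unrestricted formula: \<open>restrict\<close>
  supplies extensionality, while continuity and the derivation law only see values on
  \<open>carrier G\<close>.\<close>

lemma Der_cI:
  assumes "continuous_map (topo G) (topo A) \<alpha>"
    and "\<And>g h. \<lbrakk>g \<in> carrier G; h \<in> carrier G\<rbrakk> \<Longrightarrow> \<alpha> (g \<otimes>\<^bsub>G\<^esub> h) = \<alpha> g \<otimes>\<^bsub>A\<^esub> act A g (\<alpha> h)"
  shows "restrict \<alpha> (carrier G) \<in> Der_c G A"
  using assms continuous_map_eq[OF assms(1), of "restrict \<alpha> (carrier G)"]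
  by (simp add: Der_c_def grp.topspace_topo)

lemma Der_c_closed: "\<lbrakk>\<alpha> \<in> Der_c G A; g \<in> carrier G\<rbrakk> \<Longrightarrow> \<alpha> g \<in> carrier A"
  by (rule mdl.continuous_map_closed[of "topo G"]) (simp_all add: Der_c_def grp.topspace_topo)

lemma Der_c_mult:
  "\<lbrakk>\<alpha> \<in> Der_c G A; g \<in> carrier G; h \<in> carrier G\<rbrakk> \<Longrightarrow>
    \<alpha> (g \<otimes>\<^bsub>G\<^esub> h) = \<alpha> g \<otimes>\<^bsub>A\<^esub> act A g (\<alpha> h)"
  by (simp add: Der_c_def)

lemma Der_c_continuous: "\<alpha> \<in> Der_c G A \<Longrightarrow> continuous_map (topo G) (topo A) \<alpha>"
  by (simp add: Der_c_def)

lemma Der_c_eqI: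
  assumes "\<alpha> \<in> Der_c G A" "\<beta> \<in> Der_c G A" "\<And>g. g \<in> carrier G \<Longrightarrow> \<alpha> g = \<beta> g"
  shows "\<alpha> = \<beta>"
  using assms by (auto simp: Der_c_def intro: extensionalityI)

lemma trivial_in_Der_c: "(\<lambda>g\<in>carrier G. \<one>\<^bsub>A\<^esub>) \<in> Der_c G A"
  by (rule Der_cI) (simp_all add: mdl.topspace_topo)

text \<open>In the product of the value at \<open>g\<close> with the translate by \<open>g\<close>
  of the value at \<open>h\<close>, the inner factors \<open>act A g a\<close> and its inverse
  cancel. Starting from the trivial derivation this produces the principal ones.\<close>

lemma conjugate_in_Der_c:
  assumes "\<alpha> \<in> Der_c G A" "a \<in> carrier A"
  shows "(\<lambda>g\<in>carrier G. inv\<^bsub>A\<^esub> a \<otimes>\<^bsub>A\<^esub> \<alpha> g \<otimes>\<^bsub>A\<^esub> act A g a) \<in> Der_c G A"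
proof (rule Der_cI)
  show "continuous_map (topo G) (topo A) (\<lambda>g. inv\<^bsub>A\<^esub> a \<otimes>\<^bsub>A\<^esub> \<alpha> g \<otimes>\<^bsub>A\<^esub> act A g a)"
    using assms by (intro cont_intros Der_c_continuous continuous_map_id[unfolded id_def]) auto
qed (simp add: assms Der_c_mult Der_c_closed act_act act_mult act_m_inv mdl.m_assoc mdl.inv_mult_cancel)

section \<open>The cohomology relation and its classes\<close>

lemma cohomologousI:
  assumes "\<alpha> \<in> Der_c G A" "\<beta> \<in> Der_c G A" "a \<in> carrier A"
    and "\<And>g. g \<in> carrier G \<Longrightarrow> \<beta> g = inv\<^bsub>A\<^esub> a \<otimes>\<^bsub>A\<^esub> \<alpha> g \<otimes>\<^bsub>A\<^esub> act A g a"
  shows "(\<alpha>, \<beta>) \<in> cohomologous G A"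
  using assms unfolding cohomologous_def by blast

lemma cohomologousE:
  assumes "(\<alpha>, \<beta>) \<in> cohomologous G A"
  obtains a where "\<alpha> \<in> Der_c G A" "\<beta> \<in> Der_c G A" "a \<in> carrier A"
    "\<And>g. g \<in> carrier G \<Longrightarrow> \<beta> g = inv\<^bsub>A\<^esub> a \<otimes>\<^bsub>A\<^esub> \<alpha> g \<otimes>\<^bsub>A\<^esub> act A g a"
  using assms unfolding cohomologous_def by blast

text \<open>Twisted conjugation is a right action of \<open>A\<close> on derivations, and the
  classes are its orbits. The witnesses are the neutral element, the inverse and the
  product.\<close>

lemma equiv_cohomologous: "equiv (Der_c G A) (cohomologous G A)"
proof (rule equivI)
  show "cohomologous G A \<subseteq> Der_c G A \<times> Der_c G A"
    by (auto simp: cohomologous_def)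
  show "refl_on (Der_c G A) (cohomologous G A)"
    by (rule refl_onI) (rule cohomologousI[of _ _ "\<one>\<^bsub>A\<^esub>"]; simp add: Der_c_closed)
  show "sym (cohomologous G A)"
  proof (rule symI, elim cohomologousE)
    fix \<alpha> \<beta> a
    assume "\<alpha> \<in> Der_c G A" "\<beta> \<in> Der_c G A" "a \<in> carrier A"
      "\<And>g. g \<in> carrier G \<Longrightarrow> \<beta> g = inv\<^bsub>A\<^esub> a \<otimes>\<^bsub>A\<^esub> \<alpha> g \<otimes>\<^bsub>A\<^esub> act A g a"
    then show "(\<beta>, \<alpha>) \<in> cohomologous G A"
      by (intro cohomologousI[of _ _ "inv\<^bsub>A\<^esub> a"])
        (simp_all add: Der_c_closed act_m_inv mdl.m_assoc mdl.inv_mult_cancel)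
  qed
  show "trans (cohomologous G A)"
  proof (rule transI, elim cohomologousE)
    fix \<alpha> \<beta> \<beta>' \<gamma> a b
    assume "\<alpha> \<in> Der_c G A" "\<gamma> \<in> Der_c G A" "a \<in> carrier A" "b \<in> carrier A"
      "\<And>g. g \<in> carrier G \<Longrightarrow> \<beta> g = inv\<^bsub>A\<^esub> a \<otimes>\<^bsub>A\<^esub> \<alpha> g \<otimes>\<^bsub>A\<^esub> act A g a"
      "\<And>g. g \<in> carrier G \<Longrightarrow> \<gamma> g = inv\<^bsub>A\<^esub> b \<otimes>\<^bsub>A\<^esub> \<beta> g \<otimes>\<^bsub>A\<^esub> act A g b"
    then show "(\<alpha>, \<gamma>) \<in> cohomologous G A"
      by (intro cohomologousI[of _ _ "a \<otimes>\<^bsub>A\<^esub> b"])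
        (simp_all add: Der_c_closed act_mult mdl.m_assoc mdl.inv_mult_group)
  qed
qed

lemma H1_class_eq_iff:
  "\<lbrakk>\<alpha> \<in> Der_c G A; \<beta> \<in> Der_c G A\<rbrakk> \<Longrightarrow>
    H1_class G A \<alpha> = H1_class G A \<beta> \<longleftrightarrow> (\<alpha>, \<beta>) \<in> cohomologous G A"
  unfolding H1_class_def by (rule eq_equiv_class_iff[OF equiv_cohomologous])

lemma H1_class_in_H1: "\<alpha> \<in> Der_c G A \<Longrightarrow> H1_class G A \<alpha> \<in> fst (H1 G A)"
  by (simp add: H1_def H1_class_def quotientI)

lemma H1_E:
  assumes "X \<in> fst (H1 G A)"
  obtains \<alpha> where "\<alpha> \<in> Der_c G A" "X = H1_class G A \<alpha>"
  using assms by (auto simp: H1_def H1_class_def elim: quotientE)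

end

section \<open>Maps induced by a continuous equivariant homomorphism\<close>

lemma continuous_G_homD:
  assumes "continuous_G_hom G A B f"
  shows "f \<in> hom A B" "continuous_map (topo A) (topo B) f"
    and "\<And>g a. \<lbrakk>g \<in> carrier G; a \<in> carrier A\<rbrakk> \<Longrightarrow> f (act A g a) = act B g (f a)"
  using assms by (simp_all add: continuous_G_hom_def)

locale topological_module_hom =
  src: topological_module G A + tgt: topological_module G B
  for G :: "'g top_group" and A :: "('g, 'a) top_module" and B :: "('g, 'b) top_module" +
  fixes f :: "'a \<Rightarrow> 'b"
  assumes f: "continuous_G_hom G A B f"
begin

sublocale hm: group_hom A B f
  by unfold_locales (rule continuous_G_homD(1)[OF f])

lemmas equivariant = continuous_G_homD(3)[OF f]

lemma continuous_map_comp: "continuous_map X (topo A) u \<Longrightarrow> continuous_map X (topo B) (\<lambda>x. f (u x))"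
  using continuous_map_compose[OF _ continuous_G_homD(2)[OF f]] by (simp add: o_def)

lemma Der_c_comp: "\<alpha> \<in> Der_c G A \<Longrightarrow> (\<lambda>g\<in>carrier G. f (\<alpha> g)) \<in> Der_c G B"
  by (rule tgt.Der_cI)
    (simp_all add: continuous_map_comp src.Der_c_continuous src.Der_c_mult src.Der_c_closed equivariant)

lemma H0_map_in_H0: "a \<in> fst (H0 G A) \<Longrightarrow> f a \<in> fst (H0 G B)"
  by (auto simp: H0_def simp flip: equivariant)

lemma pointed_map_H0: "pointed_map (H0 G A) (H0_map G A f) (H0 G B)"
  by (auto simp: pointed_map_def H0_map_def H0_map_in_H0) (simp_all add: H0_def)

text \<open>If \<open>a\<close> conjugates \<open>\<alpha>\<close> into \<open>\<beta>\<close>, then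
  \<open>f a\<close> conjugates the image of \<open>\<alpha>\<close> into that of
  \<open>\<beta>\<close>. The union defining \<open>H1_map\<close> is therefore taken over equal
  classes.\<close>

lemma H1_map_class:
  assumes "\<alpha> \<in> Der_c G A"
  shows "H1_map G B f (H1_class G A \<alpha>) = H1_class G B (\<lambda>g\<in>carrier G. f (\<alpha> g))"
proof -
  have "congruent (cohomologous G A) (\<lambda>\<alpha>. H1_class G B (\<lambda>g\<in>carrier G. f (\<alpha> g)))"
  proof (rule congruentI, elim src.cohomologousE)
    fix \<alpha> \<beta> a
    assume *: "\<alpha> \<in> Der_c G A" "\<beta> \<in> Der_c G A" "a \<in> carrier A"
      "\<And>g. g \<in> carrier G \<Longrightarrow> \<beta> g = inv\<^bsub>A\<^esub> a \<otimes>\<^bsub>A\<^esub> \<alpha> g \<otimes>\<^bsub>A\<^esub> act A g a"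
    then have "((\<lambda>g\<in>carrier G. f (\<alpha> g)), (\<lambda>g\<in>carrier G. f (\<beta> g))) \<in> cohomologous G B"
      by (intro tgt.cohomologousI[of _ _ "f a"])
        (simp_all only: Der_c_comp, simp_all add: src.Der_c_closed equivariant)
    then show "H1_class G B (\<lambda>g\<in>carrier G. f (\<alpha> g)) = H1_class G B (\<lambda>g\<in>carrier G. f (\<beta> g))"
      using * by (simp add: tgt.H1_class_eq_iff Der_c_comp)
  qed
  then show ?thesis
    unfolding H1_map_def H1_class_def[of G A]
    by (rule UN_equiv_class[OF src.equiv_cohomologous _ assms])
qed

lemma pointed_map_H1: "pointed_map (H1 G A) (H1_map G B f) (H1 G B)"
proof -
  have "H1_map G B f (snd (H1 G A)) = snd (H1 G B)"
    by (simp add: H1_def H1_map_class src.trivial_in_Der_c cong: restrict_cong)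
  then show ?thesis
    by (auto simp: pointed_map_def H1_map_class tgt.H1_class_in_H1 Der_c_comp elim!: src.H1_E)
qed

end


section \<open>Exactness up to degree one\<close>

text \<open>Here \<open>\<pi>\<close> is surjective on points, with no continuous section at hand,
  so the arguments in this locale lift only single elements of \<open>C\<close> to
  \<open>B\<close>.\<close>

locale short_exact_modules =
  A: topological_module G A + B: topological_module G B + C: topological_module G C +
  i: topological_module_hom G A B \<iota> + p: topological_module_hom G B C \<pi>
  for G :: "'g top_group" and A :: "('g, 'a) top_module" and B :: "('g, 'b) top_module"
    and C :: "('g, 'c) top_module" and \<iota> :: "'a \<Rightarrow> 'b" and \<pi> :: "'b \<Rightarrow> 'c" +
  assumes embedding: "embedding_map (topo A) (topo B) \<iota>"
    and inj: "inj_on \<iota> (carrier A)"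
    and surj: "\<pi> ` carrier B = carrier C"
    and image_eq_kernel: "\<iota> ` carrier A = kernel B C \<pi>"
begin

section \<open>Lifting along \<pi> and pulling back along \<iota>\<close>

abbreviation "\<iota>_inv \<equiv> inv_into (carrier A) \<iota>"

lemma \<pi>_\<iota> [simp]: "a \<in> carrier A \<Longrightarrow> \<pi> (\<iota> a) = \<one>\<^bsub>C\<^esub>"
  using image_eq_kernel by (auto simp: kernel_def)

lemma
  assumes "b \<in> carrier B" "\<pi> b = \<one>\<^bsub>C\<^esub>"
  shows \<iota>_inv_closed [simp]: "\<iota>_inv b \<in> carrier A"
    and \<iota>_\<iota>_inv [simp]: "\<iota> (\<iota>_inv b) = b"
proof -
  have "b \<in> \<iota> ` carrier A"
    using assms image_eq_kernel by (simp add: kernel_def)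
  then show "\<iota>_inv b \<in> carrier A" "\<iota> (\<iota>_inv b) = b"
    by (rule inv_into_into, rule f_inv_into_f)
qed

lemma \<iota>_inv_\<iota> [simp]: "a \<in> carrier A \<Longrightarrow> \<iota>_inv (\<iota> a) = a"
  by (rule inv_into_f_f[OF inj])

lemma \<iota>_eqD: "\<lbrakk>\<iota> a = \<iota> a'; a \<in> carrier A; a' \<in> carrier A\<rbrakk> \<Longrightarrow> a = a'"
  using inj by (rule inj_onD)

lemma lift:
  assumes "c \<in> carrier C"
  obtains b where "b \<in> carrier B" "\<pi> b = c"
proof -
  have "c \<in> \<pi> ` carrier B"
    using assms surj by simp
  then show thesis
    by (rule imageE) (rule that[OF _ sym])
qed

text \<open>An embedding is a homeomorphism onto its image, so it has a continuous inverse
  \<open>j\<close> there. By exactness \<open>u\<close> takes values in this image, where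
  \<open>j\<close> agrees with \<open>\<iota>_inv\<close>.\<close>

lemma continuous_map_\<iota>_inv:
  assumes "continuous_map X (topo B) u" and "\<And>x. x \<in> topspace X \<Longrightarrow> \<pi> (u x) = \<one>\<^bsub>C\<^esub>"
  shows "continuous_map X (topo A) (\<lambda>x. \<iota>_inv (u x))"
proof -
  obtain j where j: "continuous_map (subtopology (topo B) (\<iota> ` topspace (topo A))) (topo A) j"
    and ji: "\<And>a. a \<in> carrier A \<Longrightarrow> j (\<iota> a) = a"
    using embedding
    by (auto simp: embedding_map_def homeomorphic_map_maps homeomorphic_maps_def A.mdl.topspace_topo)
  have u: "u x \<in> carrier B" if "x \<in> topspace X" for x
    by (rule B.mdl.continuous_map_closed[OF assms(1) that])
  have u_im: "u x \<in> \<iota> ` carrier A" if "x \<in> topspace X" for x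
    using u[OF that] assms(2)[OF that] image_eq_kernel by (simp add: kernel_def)
  then have "continuous_map X (subtopology (topo B) (\<iota> ` topspace (topo A))) u"
    using assms(1) by (auto simp: continuous_map_in_subtopology A.mdl.topspace_topo)
  from continuous_map_compose[OF this j] show ?thesis
  proof (rule continuous_map_eq)
    show "(j \<circ> u) x = \<iota>_inv (u x)" if "x \<in> topspace X" for x
      using u_im[OF that] by (auto simp: ji)
  qed
qed

text \<open>After applying \<open>\<iota>\<close>, the derivation law for the pull-back is that of
  \<open>\<beta>\<close>; injectivity then removes \<open>\<iota>\<close>.\<close>

lemma Der_c_\<iota>_inv:
  assumes "\<beta> \<in> Der_c G B" and "\<And>g. g \<in> carrier G \<Longrightarrow> \<pi> (\<beta> g) = \<one>\<^bsub>C\<^esub>"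
  shows "(\<lambda>g\<in>carrier G. \<iota>_inv (\<beta> g)) \<in> Der_c G A"
proof (rule A.Der_cI)
  show "continuous_map (topo G) (topo A) (\<lambda>g. \<iota>_inv (\<beta> g))"
    using assms by (intro continuous_map_\<iota>_inv B.Der_c_continuous) (simp_all add: A.grp.topspace_topo)
next
  fix g h
  assume gh: "g \<in> carrier G" "h \<in> carrier G"
  have "\<iota> (\<iota>_inv (\<beta> (g \<otimes>\<^bsub>G\<^esub> h))) = \<iota> (\<iota>_inv (\<beta> g) \<otimes>\<^bsub>A\<^esub> act A g (\<iota>_inv (\<beta> h)))"
    using gh assms by (simp add: B.Der_c_closed i.equivariant B.Der_c_mult[symmetric])
  then show "\<iota>_inv (\<beta> (g \<otimes>\<^bsub>G\<^esub> h)) = \<iota>_inv (\<beta> g) \<otimes>\<^bsub>A\<^esub> act A g (\<iota>_inv (\<beta> h))"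
    using gh assms by (intro \<iota>_eqD) (simp_all add: B.Der_c_closed)
qed

section \<open>Exactness at the invariants of A and of B\<close>

lemma exact_at_H0_left: "exact_at point (\<lambda>_. \<one>\<^bsub>A\<^esub>) (H0 G A) (H0_map G A \<iota>) (H0 G B)"
proof -
  have "a = \<one>\<^bsub>A\<^esub>" if "a \<in> carrier A" "\<iota> a = \<one>\<^bsub>B\<^esub>" for a
    using that by (intro \<iota>_eqD) auto
  then show ?thesis
    unfolding exact_at_def
    by (intro conjI i.pointed_map_H0) (auto simp: pointed_map_def point_def H0_def H0_map_def)
qed

text \<open>An invariant \<open>b\<close> in the kernel of \<open>\<pi>\<close> comes from
  \<open>\<iota>_inv b\<close>, whose invariance can be checked after applying the injective
  equivariant map \<open>\<iota>\<close>.\<close>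

lemma exact_at_H0_middle: "exact_at (H0 G A) (H0_map G A \<iota>) (H0 G B) (H0_map G B \<pi>) (H0 G C)"
proof -
  have "b \<in> H0_map G A \<iota> ` fst (H0 G A)"
    if b: "b \<in> fst (H0 G B)" and "H0_map G B \<pi> b = snd (H0 G C)" for b
  proof
    have *: "b \<in> carrier B" "\<pi> b = \<one>\<^bsub>C\<^esub>" "\<And>g. g \<in> carrier G \<Longrightarrow> act B g b = b"
      using that by (auto simp: H0_def H0_map_def)
    have "act A g (\<iota>_inv b) = \<iota>_inv b" if "g \<in> carrier G" for g
      using * that by (intro \<iota>_eqD) (simp_all add: i.equivariant)
    then show "\<iota>_inv b \<in> fst (H0 G A)"
      using * by (simp add: H0_def)
    then show "b = H0_map G A \<iota> (\<iota>_inv b)"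
      using * by (simp add: H0_map_def)
  qed
  moreover have "H0_map G B \<pi> (H0_map G A \<iota> a) = snd (H0 G C)" if "a \<in> fst (H0 G A)" for a
    using that i.H0_map_in_H0[OF that] by (simp add: H0_map_def) (simp add: H0_def)
  ultimately show ?thesis
    unfolding exact_at_def using i.pointed_map_H0 p.pointed_map_H0
    by (auto simp: pointed_map_def)
qed

section \<open>The connecting map in degree zero\<close>

text \<open>Invariance of \<open>\<pi> b\<close> makes the two factors cancel in \<open>C\<close>;
  this is what gives meaning to \<open>\<iota>_inv\<close> in \<open>delta0\<close>.\<close>

lemma coboundary_lift_in_kernel:
  assumes "b \<in> carrier B" "\<pi> b \<in> fst (H0 G C)" "g \<in> carrier G"
  shows "\<pi> (inv\<^bsub>B\<^esub> b \<otimes>\<^bsub>B\<^esub> act B g b) = \<one>\<^bsub>C\<^esub>"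
  using assms by (simp add: p.equivariant H0_def)

text \<open>Before the pull-back this is the principal derivation of \<open>b\<close> in
  \<open>B\<close>, a conjugate of the trivial one.\<close>

lemma coboundary_lift_in_Der_c:
  assumes "b \<in> carrier B" "\<pi> b \<in> fst (H0 G C)"
  shows "(\<lambda>g\<in>carrier G. \<iota>_inv (inv\<^bsub>B\<^esub> b \<otimes>\<^bsub>B\<^esub> act B g b)) \<in> Der_c G A"
proof -
  have "(\<lambda>g\<in>carrier G. inv\<^bsub>B\<^esub> b \<otimes>\<^bsub>B\<^esub> act B g b) \<in> Der_c G B"
    using B.conjugate_in_Der_c[OF B.trivial_in_Der_c assms(1)] assms(1)
    by (simp cong: restrict_cong)
  from Der_c_\<iota>_inv[OF this] show ?thesis
    using coboundary_lift_in_kernel[OF assms] by (simp cong: restrict_cong)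
qed

text \<open>Two lifts of the same element differ by an element of \<open>A\<close>, and conjugation
  by that element carries one derivation into the other. So any lift computes
  \<open>delta0\<close>.\<close>

lemma delta0_\<pi>:
  assumes b: "b \<in> carrier B" "\<pi> b \<in> fst (H0 G C)"
  shows "delta0 G A B \<iota> \<pi> (\<pi> b) =
    H1_class G A (\<lambda>g\<in>carrier G. \<iota>_inv (inv\<^bsub>B\<^esub> b \<otimes>\<^bsub>B\<^esub> act B g b))"
  unfolding delta0_def
proof (rule UN_constant_eq[OF _ ballI])
  show "b \<in> {b' \<in> carrier B. \<pi> b' = \<pi> b}"
    using b by simp
  show "H1_class G A (\<lambda>g\<in>carrier G. \<iota>_inv (inv\<^bsub>B\<^esub> b' \<otimes>\<^bsub>B\<^esub> act B g b')) =
      H1_class G A (\<lambda>g\<in>carrier G. \<iota>_inv (inv\<^bsub>B\<^esub> b \<otimes>\<^bsub>B\<^esub> act B g b))"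
    if "b' \<in> {b' \<in> carrier B. \<pi> b' = \<pi> b}" for b'
  proof -
    have b': "b' \<in> carrier B" "\<pi> b' = \<pi> b" "\<pi> b' \<in> fst (H0 G C)"
      using that b by simp_all
    define a where "a = \<iota>_inv (inv\<^bsub>B\<^esub> b' \<otimes>\<^bsub>B\<^esub> b)"
    have a: "a \<in> carrier A" "\<iota> a = inv\<^bsub>B\<^esub> b' \<otimes>\<^bsub>B\<^esub> b"
      unfolding a_def using b b' by simp_all
    \<comment> \<open>Both sides are compared in \<open>B\<close>, where \<open>b\<close> is the
      product of \<open>b'\<close> and \<open>\<iota> a\<close>. The rule \<open>hom_mult\<close>
      for \<open>\<pi>\<close> is withheld so that the kernel facts keep the form in which
      \<open>\<iota>_\<iota>_inv\<close> asks for them.\<close>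
    have "\<iota>_inv (inv\<^bsub>B\<^esub> b \<otimes>\<^bsub>B\<^esub> act B g b) =
        inv\<^bsub>A\<^esub> a \<otimes>\<^bsub>A\<^esub> \<iota>_inv (inv\<^bsub>B\<^esub> b' \<otimes>\<^bsub>B\<^esub> act B g b') \<otimes>\<^bsub>A\<^esub> act A g a" if g: "g \<in> carrier G" for g
      using b b' a g coboundary_lift_in_kernel[OF b g] coboundary_lift_in_kernel[OF b'(1,3) g]
      by (intro \<iota>_eqD) (simp_all add: i.equivariant B.act_mult B.act_m_inv B.mdl.m_assoc
          B.mdl.inv_mult_group B.mdl.inv_mult_cancel del: p.hm.hom_mult)
    then show ?thesis
      using coboundary_lift_in_Der_c[OF b] coboundary_lift_in_Der_c[OF b'(1,3)] a(1)
      by (subst A.H1_class_eq_iff) (auto intro!: A.cohomologousI[of _ _ a])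
  qed
qed

lemma pointed_map_delta0: "pointed_map (H0 G C) (delta0 G A B \<iota> \<pi>) (H1 G A)"
proof -
  have "delta0 G A B \<iota> \<pi> c \<in> fst (H1 G A)" if c: "c \<in> fst (H0 G C)" for c
  proof -
    obtain b where b: "b \<in> carrier B" "\<pi> b = c"
      using c by (auto simp: H0_def intro: lift)
    then show ?thesis
      using c delta0_\<pi>[of b] coboundary_lift_in_Der_c[of b] by (simp add: A.H1_class_in_H1)
  qed
  moreover have "delta0 G A B \<iota> \<pi> (snd (H0 G C)) = snd (H1 G A)"
  proof -
    \<comment> \<open>The basepoint is lifted by the neutral element of \<open>B\<close>, whose
      principal derivation is trivial.\<close>
    have "\<pi> \<one>\<^bsub>B\<^esub> \<in> fst (H0 G C)"
      by (simp add: H0_def)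
    from delta0_\<pi>[OF _ this] show ?thesis
      using \<iota>_inv_\<iota>[of "\<one>\<^bsub>A\<^esub>"] by (simp add: H1_def H0_def cong: restrict_cong)
  qed
  ultimately show ?thesis
    by (simp add: pointed_map_def image_subset_iff)
qed

text \<open>An invariant lift has trivial principal derivation. Conversely, if the derivation of
  some lift is principal already in \<open>A\<close>, the lift can be corrected by an element of
  \<open>A\<close> to an invariant one.\<close>

lemma exact_at_H0_right: "exact_at (H0 G B) (H0_map G B \<pi>) (H0 G C) (delta0 G A B \<iota> \<pi>) (H1 G A)"
proof -
  have "delta0 G A B \<iota> \<pi> (\<pi> b) = snd (H1 G A)" if b: "b \<in> fst (H0 G B)" for b
  proof -
    have "b \<in> carrier B" "\<And>g. g \<in> carrier G \<Longrightarrow> act B g b = b"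
      using b by (simp_all add: H0_def)
    then show ?thesis
      using p.H0_map_in_H0[OF b] \<iota>_inv_\<iota>[of "\<one>\<^bsub>A\<^esub>"]
      by (simp add: delta0_\<pi> H1_def cong: restrict_cong)
  qed
  moreover have "c \<in> H0_map G B \<pi> ` fst (H0 G B)"
    if c: "c \<in> fst (H0 G C)" and "delta0 G A B \<iota> \<pi> c = snd (H1 G A)" for c
  proof -
    obtain b where b: "b \<in> carrier B" "\<pi> b = c"
      using c by (auto simp: H0_def intro: lift)
    have "H1_class G A (\<lambda>g\<in>carrier G. \<one>\<^bsub>A\<^esub>) =
        H1_class G A (\<lambda>g\<in>carrier G. \<iota>_inv (inv\<^bsub>B\<^esub> b \<otimes>\<^bsub>B\<^esub> act B g b))"
      using that b delta0_\<pi>[of b] by (simp add: H1_def)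
    then have "((\<lambda>g\<in>carrier G. \<one>\<^bsub>A\<^esub>), (\<lambda>g\<in>carrier G. \<iota>_inv (inv\<^bsub>B\<^esub> b \<otimes>\<^bsub>B\<^esub> act B g b)))
        \<in> cohomologous G A"
      using c b coboundary_lift_in_Der_c[of b] by (simp add: A.H1_class_eq_iff A.trivial_in_Der_c)
    then obtain a where a: "a \<in> carrier A" and
      eq: "\<And>g. g \<in> carrier G \<Longrightarrow> \<iota>_inv (inv\<^bsub>B\<^esub> b \<otimes>\<^bsub>B\<^esub> act B g b) = inv\<^bsub>A\<^esub> a \<otimes>\<^bsub>A\<^esub> act A g a"
      by (elim A.cohomologousE) simp
    \<comment> \<open>By \<open>eq\<close>, \<open>b\<close> and \<open>\<iota> a\<close> have the
      same principal derivation in \<open>B\<close>, so their quotient is invariant. It still lies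
      over \<open>c\<close>, because \<open>\<pi>\<close> kills \<open>\<iota> a\<close>.\<close>
    define b' where "b' = b \<otimes>\<^bsub>B\<^esub> inv\<^bsub>B\<^esub> \<iota> a"
    have b': "b' \<in> carrier B" "\<pi> b' = c"
      using a b p.hm.hom_closed[OF b(1)] unfolding b'_def by simp_all
    have "act B g b' = b'" if g: "g \<in> carrier G" for g
    proof -
      have "\<iota> (\<iota>_inv (inv\<^bsub>B\<^esub> b \<otimes>\<^bsub>B\<^esub> act B g b)) = \<iota> (inv\<^bsub>A\<^esub> a \<otimes>\<^bsub>A\<^esub> act A g a)"
        using eq[OF g] by simp
      then have *: "inv\<^bsub>B\<^esub> b \<otimes>\<^bsub>B\<^esub> act B g b = inv\<^bsub>B\<^esub> \<iota> a \<otimes>\<^bsub>B\<^esub> act B g (\<iota> a)"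
        using a b c g coboundary_lift_in_kernel[of b g] by (simp add: i.equivariant del: p.hm.hom_mult)
      have "act B g b = b \<otimes>\<^bsub>B\<^esub> (inv\<^bsub>B\<^esub> b \<otimes>\<^bsub>B\<^esub> act B g b)"
        using b g by (simp add: B.mdl.inv_mult_cancel)
      also have "\<dots> = b' \<otimes>\<^bsub>B\<^esub> act B g (\<iota> a)"
        using a b g by (simp add: * b'_def B.mdl.m_assoc)
      finally show ?thesis
        using a b g b'(1) by (simp add: b'_def B.act_mult B.act_m_inv B.mdl.m_assoc)
    qed
    then have "b' \<in> fst (H0 G B)"
      using b' by (simp add: H0_def)
    then show ?thesis
      using b' by (auto simp: H0_map_def image_iff)
  qed
  ultimately show ?thesis
    unfolding exact_at_def using p.pointed_map_H0 pointed_map_delta0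
    by (auto simp: pointed_map_def H0_map_def)
qed

section \<open>Exactness at the first cohomology of A and of B\<close>

text \<open>A derivation in the image of \<open>delta0\<close> becomes principal in
  \<open>B\<close>, with the lift \<open>b\<close> as witness. Conversely, if \<open>\<iota>\<close>
  makes \<open>\<alpha>\<close> principal with witness \<open>b\<close>, applying
  \<open>\<pi>\<close> shows that \<open>\<pi> b\<close> is invariant, and \<open>b\<close> is a
  lift computing its image under \<open>delta0\<close>.\<close>

lemma exact_at_H1_left: "exact_at (H0 G C) (delta0 G A B \<iota> \<pi>) (H1 G A) (H1_map G B \<iota>) (H1 G B)"
proof -
  have "H1_map G B \<iota> (delta0 G A B \<iota> \<pi> c) = snd (H1 G B)" if c: "c \<in> fst (H0 G C)" for c
  proof -
    obtain b where b: "b \<in> carrier B" "\<pi> b = c"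
      using c by (auto simp: H0_def intro: lift)
    let ?\<alpha> = "\<lambda>g\<in>carrier G. \<iota>_inv (inv\<^bsub>B\<^esub> b \<otimes>\<^bsub>B\<^esub> act B g b)"
    have \<alpha>: "?\<alpha> \<in> Der_c G A"
      using b c by (simp add: coboundary_lift_in_Der_c)
    have "((\<lambda>g\<in>carrier G. \<one>\<^bsub>B\<^esub>), (\<lambda>g\<in>carrier G. \<iota> (?\<alpha> g))) \<in> cohomologous G B"
      using b c coboundary_lift_in_kernel[of b] i.Der_c_comp[OF \<alpha>]
      by (intro B.cohomologousI[of _ _ b] B.trivial_in_Der_c) (simp_all del: p.hm.hom_mult)
    then have "H1_map G B \<iota> (H1_class G A ?\<alpha>) = snd (H1 G B)"
      unfolding i.H1_map_class[OF \<alpha>] H1_def snd_conv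
      using i.Der_c_comp[OF \<alpha>] B.H1_class_eq_iff B.trivial_in_Der_c by metis
    then show ?thesis
      using b c delta0_\<pi>[of b] by simp
  qed
  moreover have "X \<in> delta0 G A B \<iota> \<pi> ` fst (H0 G C)"
    if "X \<in> fst (H1 G A)" and "H1_map G B \<iota> X = snd (H1 G B)" for X
  proof -
    obtain \<alpha> where \<alpha>: "\<alpha> \<in> Der_c G A" and X: "X = H1_class G A \<alpha>"
      using \<open>X \<in> fst (H1 G A)\<close> by (rule A.H1_E)
    have "((\<lambda>g\<in>carrier G. \<one>\<^bsub>B\<^esub>), (\<lambda>g\<in>carrier G. \<iota> (\<alpha> g))) \<in> cohomologous G B"
      using that(2) \<alpha> i.Der_c_comp[OF \<alpha>]
      by (simp add: X i.H1_map_class H1_def B.trivial_in_Der_c flip: B.H1_class_eq_iff)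
    then obtain b where b: "b \<in> carrier B" and
      eq: "\<And>g. g \<in> carrier G \<Longrightarrow> \<iota> (\<alpha> g) = inv\<^bsub>B\<^esub> b \<otimes>\<^bsub>B\<^esub> act B g b"
      by (elim B.cohomologousE) simp
    have "act C g (\<pi> b) = \<pi> b" if g: "g \<in> carrier G" for g
    proof -
      have "\<pi> (inv\<^bsub>B\<^esub> b \<otimes>\<^bsub>B\<^esub> act B g b) = \<one>\<^bsub>C\<^esub>"
        using \<alpha> g by (simp add: A.Der_c_closed flip: eq)
      then have "inv\<^bsub>C\<^esub> \<pi> b \<otimes>\<^bsub>C\<^esub> act C g (\<pi> b) = \<one>\<^bsub>C\<^esub>"
        using b g by (simp add: p.equivariant)
      then show ?thesis
        using b g C.mdl.inv_mult_cancel(2)[of "\<pi> b" "act C g (\<pi> b)"] by simp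
    qed
    then have c: "\<pi> b \<in> fst (H0 G C)"
      using b by (simp add: H0_def)
    \<comment> \<open>With this choice of lift the two derivations are equal, not merely
      cohomologous.\<close>
    have "\<alpha> = (\<lambda>g\<in>carrier G. \<iota>_inv (inv\<^bsub>B\<^esub> b \<otimes>\<^bsub>B\<^esub> act B g b))"
      using \<alpha> coboundary_lift_in_Der_c[OF b c]
      by (rule A.Der_c_eqI) (use \<alpha> in \<open>simp add: A.Der_c_closed flip: eq\<close>)
    then show ?thesis
      using delta0_\<pi>[OF b c] c X by (auto simp: image_iff)
  qed
  ultimately show ?thesis
    unfolding exact_at_def using pointed_map_delta0 i.pointed_map_H1
    by (auto simp: pointed_map_def)
qed

text \<open>If the image of \<open>\<beta>\<close> in \<open>C\<close> is principal with witness
  \<open>c\<close>, conjugating \<open>\<beta>\<close> by the inverse of a lift of \<open>c\<close>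
  makes all values lie in the kernel of \<open>\<pi>\<close>, and the result pulls back to
  \<open>A\<close>.\<close>

lemma exact_at_H1_middle: "exact_at (H1 G A) (H1_map G B \<iota>) (H1 G B) (H1_map G C \<pi>) (H1 G C)"
proof -
  have "H1_map G C \<pi> (H1_map G B \<iota> X) = snd (H1 G C)" if "X \<in> fst (H1 G A)" for X
    using that by (elim A.H1_E)
      (simp add: i.H1_map_class p.H1_map_class i.Der_c_comp A.Der_c_closed H1_def cong: restrict_cong)
  moreover have "Y \<in> H1_map G B \<iota> ` fst (H1 G A)"
    if "Y \<in> fst (H1 G B)" and "H1_map G C \<pi> Y = snd (H1 G C)" for Y
  proof -
    obtain \<beta> where \<beta>: "\<beta> \<in> Der_c G B" and Y: "Y = H1_class G B \<beta>"
      using \<open>Y \<in> fst (H1 G B)\<close> by (rule B.H1_E)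
    have "((\<lambda>g\<in>carrier G. \<one>\<^bsub>C\<^esub>), (\<lambda>g\<in>carrier G. \<pi> (\<beta> g))) \<in> cohomologous G C"
      using that(2) \<beta> p.Der_c_comp[OF \<beta>]
      by (simp add: Y p.H1_map_class H1_def C.trivial_in_Der_c flip: C.H1_class_eq_iff)
    then obtain c where c: "c \<in> carrier C" and
      eq: "\<And>g. g \<in> carrier G \<Longrightarrow> \<pi> (\<beta> g) = inv\<^bsub>C\<^esub> c \<otimes>\<^bsub>C\<^esub> act C g c"
      by (elim C.cohomologousE) simp
    obtain b where b: "b \<in> carrier B" "\<pi> b = c"
      using c by (rule lift)
    \<comment> \<open>The double inverse keeps the shape of conjugation by the inverse of
      \<open>b\<close>, as required by \<open>conjugate_in_Der_c\<close> and
      \<open>cohomologousI\<close>.\<close>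
    define \<beta>' where "\<beta>' = (\<lambda>g\<in>carrier G. inv\<^bsub>B\<^esub> (inv\<^bsub>B\<^esub> b) \<otimes>\<^bsub>B\<^esub> \<beta> g \<otimes>\<^bsub>B\<^esub> act B g (inv\<^bsub>B\<^esub> b))"
    have \<beta>': "\<beta>' \<in> Der_c G B"
      unfolding \<beta>'_def using \<beta> b by (intro B.conjugate_in_Der_c) simp_all
    have cohom: "(\<beta>, \<beta>') \<in> cohomologous G B"
      using \<beta> \<beta>' b by (intro B.cohomologousI[of _ _ "inv\<^bsub>B\<^esub> b"]) (simp_all add: \<beta>'_def)
    have ker: "\<pi> (\<beta>' g) = \<one>\<^bsub>C\<^esub>" if "g \<in> carrier G" for g
      using that b c \<beta> by (simp add: \<beta>'_def B.Der_c_closed p.equivariant C.act_m_inv eq C.mdl.m_assoc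
          C.mdl.inv_mult_cancel)
    let ?\<alpha> = "\<lambda>g\<in>carrier G. \<iota>_inv (\<beta>' g)"
    have \<alpha>: "?\<alpha> \<in> Der_c G A"
      using \<beta>' ker by (rule Der_c_\<iota>_inv)
    have "(\<lambda>g\<in>carrier G. \<iota> (?\<alpha> g)) = \<beta>'"
      using i.Der_c_comp[OF \<alpha>] \<beta>' by (rule B.Der_c_eqI) (simp add: ker \<beta>' B.Der_c_closed)
    then have "H1_map G B \<iota> (H1_class G A ?\<alpha>) = Y"
      using cohom by (simp add: i.H1_map_class[OF \<alpha>] Y B.H1_class_eq_iff[OF \<beta> \<beta>', symmetric])
    then show ?thesis
      using A.H1_class_in_H1[OF \<alpha>] by blast
  qed
  ultimately show ?thesis
    unfolding exact_at_def using i.pointed_map_H1 p.pointed_map_H1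
    by (auto simp: pointed_map_def)
qed

end


section \<open>Two-cocycles\<close>

locale abelian_topological_module = topological_module G A
  for G :: "'g top_group" and A :: "('g, 'a) top_module" +
  assumes A_comm: "\<lbrakk>a \<in> carrier A; b \<in> carrier A\<rbrakk> \<Longrightarrow> a \<otimes>\<^bsub>A\<^esub> b = b \<otimes>\<^bsub>A\<^esub> a"
begin

sublocale ab: comm_group A
  by unfold_locales (rule A_comm)

section \<open>Cochains and differentials in low degrees\<close>

lemma topspace_power: "topspace (product_topology (\<lambda>_. topo G) {1..n}) = group_power G n"
  by (simp add: grp.topspace_topo group_power_def)

lemma hu_cochain_iff:
  "f \<in> carrier (hu_cochains G A n) \<longleftrightarrow> f \<in> extensional (group_power G n) \<and>
    continuous_map (product_topology (\<lambda>_. topo G) {1..n}) (topo A) f"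
  by (simp add: hu_cochains_def)

lemma hu_cochainI:
  assumes "continuous_map (product_topology (\<lambda>_. topo G) {1..n}) (topo A) f"
  shows "restrict f (group_power G n) \<in> carrier (hu_cochains G A n)"
proof -
  have "continuous_map (product_topology (\<lambda>_. topo G) {1..n}) (topo A) (restrict f (group_power G n))"
    using assms by (rule continuous_map_eq) (simp only: topspace_power restrict_apply')
  then show ?thesis
    by (simp add: hu_cochain_iff)
qed

lemma hu_cochain_closed:
  assumes "f \<in> carrier (hu_cochains G A n)" "x \<in> group_power G n"
  shows "f x \<in> carrier A"
  using assms mdl.continuous_map_closed[of "product_topology (\<lambda>_. topo G) {1..n}" f x]
  by (simp only: hu_cochain_iff topspace_power)

lemma group_power_2D:
  assumes "x \<in> group_power G 2"
  shows "x 1 \<in> carrier G" "x 2 \<in> carrier G"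
  using assms by (auto simp: group_power_def)

text \<open>The structure is pointwise, and continuity of the operations of \<open>A\<close> gives
  closure. This is the ambient group in which all cosets below are computed.\<close>

lemma group_hu_cochains: "group (hu_cochains G A n)"
proof (rule groupI)
  show "f \<otimes>\<^bsub>hu_cochains G A n\<^esub> f' \<in> carrier (hu_cochains G A n)"
    if "f \<in> carrier (hu_cochains G A n)" "f' \<in> carrier (hu_cochains G A n)" for f f'
    using hu_cochainI[OF mdl.continuous_map_mult, of n f f'] that
    by (simp add: hu_cochain_iff) (simp add: hu_cochains_def)
  show "\<one>\<^bsub>hu_cochains G A n\<^esub> \<in> carrier (hu_cochains G A n)"
    using hu_cochainI[OF continuous_map_const_carrier[OF mdl.one_closed]]
    by (simp add: hu_cochains_def)
  show "\<exists>f'\<in>carrier (hu_cochains G A n). f' \<otimes>\<^bsub>hu_cochains G A n\<^esub> f = \<one>\<^bsub>hu_cochains G A n\<^esub>"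
    if f: "f \<in> carrier (hu_cochains G A n)" for f
  proof
    show "(\<lambda>x\<in>group_power G n. inv\<^bsub>A\<^esub> f x) \<in> carrier (hu_cochains G A n)"
      using f by (intro hu_cochainI mdl.continuous_map_m_inv) (simp add: hu_cochain_iff)
    show "(\<lambda>x\<in>group_power G n. inv\<^bsub>A\<^esub> f x) \<otimes>\<^bsub>hu_cochains G A n\<^esub> f = \<one>\<^bsub>hu_cochains G A n\<^esub>"
      using hu_cochain_closed[OF f] by (auto simp: hu_cochains_def intro!: restrict_ext)
  qed
  show "\<one>\<^bsub>hu_cochains G A n\<^esub> \<otimes>\<^bsub>hu_cochains G A n\<^esub> f = f" if f: "f \<in> carrier (hu_cochains G A n)" for f
    using hu_cochain_closed[OF f] f
    by (auto simp: hu_cochains_def extensional_def restrict_def fun_eq_iff)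
qed (auto simp: hu_cochains_def mdl.m_assoc dest!: hu_cochain_closed[unfolded hu_cochain_iff, OF conjI]
    intro!: restrict_ext)

text \<open>With \<open>cochain2\<close>, translates between cochains on tuples and ordinary
  functions of one or two group elements, in which the calculations are done.\<close>

definition cochain1 :: "('g \<Rightarrow> 'a) \<Rightarrow> (nat \<Rightarrow> 'g) \<Rightarrow> 'a"
  where "cochain1 u = (\<lambda>x\<in>group_power G 1. u (x 1))"

definition cochain2 :: "('g \<Rightarrow> 'g \<Rightarrow> 'a) \<Rightarrow> (nat \<Rightarrow> 'g) \<Rightarrow> 'a"
  where "cochain2 F = (\<lambda>x\<in>group_power G 2. F (x 1) (x 2))"

text \<open>The Hu differential in degree one; additively,
  \<open>g u(h) - u(gh) + u(g)\<close>.\<close>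

definition coboundary :: "('g \<Rightarrow> 'a) \<Rightarrow> 'g \<Rightarrow> 'g \<Rightarrow> 'a"
  where "coboundary u g h = act A g (u h) \<otimes>\<^bsub>A\<^esub> inv\<^bsub>A\<^esub> u (g \<otimes>\<^bsub>G\<^esub> h) \<otimes>\<^bsub>A\<^esub> u g"

lemma cochain2_eq_iff:
  "cochain2 F = cochain2 F' \<longleftrightarrow> (\<forall>g\<in>carrier G. \<forall>h\<in>carrier G. F g h = F' g h)"
proof (intro iffI ballI)
  fix g h
  assume eq: "cochain2 F = cochain2 F'" and "g \<in> carrier G" "h \<in> carrier G"
  then have "(\<lambda>j\<in>{1..2}. if j = 1 then g else h) \<in> group_power G 2"
    by (auto simp: group_power_def)
  with fun_cong[OF eq, of "\<lambda>j\<in>{1..2}. if j = 1 then g else h"] show "F g h = F' g h"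
    by (simp add: cochain2_def)
next
  assume "\<forall>g\<in>carrier G. \<forall>h\<in>carrier G. F g h = F' g h"
  then show "cochain2 F = cochain2 F'"
    \<comment> \<open>\<open>One_nat_def\<close> would rewrite \<open>x 1\<close> to
      \<open>x (Suc 0)\<close>, which \<open>group_power_2D\<close> does not match.\<close>
    unfolding cochain2_def by (intro restrict_ext) (simp add: group_power_2D del: One_nat_def)
qed

lemma continuous_map_power_coord:
  assumes "continuous_map (topo G) X u" "i \<in> {1..n}"
  shows "continuous_map (product_topology (\<lambda>_. topo G) {1..n}) X (\<lambda>x. u (x i))"
  using continuous_map_compose[OF continuous_map_product_projection[OF assms(2), of "\<lambda>_. topo G"] assms(1)]
  by (simp add: o_def)

lemma cochain1_in_hu_cochains:
  assumes "continuous_map (topo G) (topo A) u"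
  shows "cochain1 u \<in> carrier (hu_cochains G A 1)"
  unfolding cochain1_def by (intro hu_cochainI continuous_map_power_coord assms) simp

text \<open>Sending \<open>g\<close> to the one-entry tuple is continuous, so \<open>u\<close> is
  obtained from \<open>f\<close> by composition; a tuple of length one is recovered from its
  entry.\<close>

lemma hu_cochain1_E:
  assumes "f \<in> carrier (hu_cochains G A 1)"
  obtains u where "continuous_map (topo G) (topo A) u" "f = cochain1 u"
proof
  have "continuous_map (topo G) (product_topology (\<lambda>_. topo G) {1..1}) (\<lambda>g. \<lambda>j\<in>{1..1}. g)"
    by (auto simp: continuous_map_componentwise)
  moreover have "continuous_map (product_topology (\<lambda>_. topo G) {1..1}) (topo A) f"
    using assms by (simp only: hu_cochain_iff)
  ultimately have "continuous_map (topo G) (topo A) (f \<circ> (\<lambda>g. \<lambda>j\<in>{1..1}. g))"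
    by (rule continuous_map_compose)
  then show "continuous_map (topo G) (topo A) (\<lambda>g. f (\<lambda>j\<in>{1..1}. g))"
    by (simp only: o_def)
  show "f = cochain1 (\<lambda>g. f (\<lambda>j\<in>{1..1}. g))"
  proof (rule extensionalityI[of _ "group_power G 1"])
    fix x
    assume x: "x \<in> group_power G 1"
    then have "(\<lambda>j\<in>{1..1}. x 1) = x"
      by (auto simp: group_power_def fun_eq_iff restrict_def PiE_def extensional_def)
    with x show "f x = cochain1 (\<lambda>g. f (\<lambda>j\<in>{1..1}. g)) x"
      by (simp only: cochain1_def restrict_apply')
  qed (use assms in \<open>simp_all only: hu_cochain_iff cochain1_def restrict_extensional\<close>)
qed

text \<open>For \<open>n = 1\<close> the inner product has a single factor, an inverse, and the last
  exponent is \<open>(-1)^2 = 1\<close>.\<close>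

lemma hu_delta_cochain1:
  assumes u: "continuous_map (topo G) (topo A) u"
  shows "hu_delta G A 1 (cochain1 u) = cochain2 (coboundary u)"
  unfolding hu_delta_def cochain2_def Suc_1
proof (rule restrict_ext)
  fix x
  assume x: "x \<in> group_power G 2"
  have uc: "u g \<in> carrier A" if "g \<in> carrier G" for g
    using mdl.continuous_map_closed[OF u] that grp.topspace_topo by simp
  have x12: "x 1 \<in> carrier G" "x 2 \<in> carrier G"
    using x by (auto simp: group_power_def)
  have "cochain1 u (\<lambda>j\<in>{1..1}. x (Suc j)) = u (x 2)"
    "cochain1 u (\<lambda>j\<in>{1..1}. x j) = u (x 1)"
    "cochain1 u (merge_entries G 1 1 x) = u (x 1 \<otimes>\<^bsub>G\<^esub> x 2)"
    using x12 by (auto simp: cochain1_def group_power_def merge_entries_def numeral_2_eq_2)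
  then show "act A (x 1) (cochain1 u (\<lambda>j\<in>{1..1}. x (Suc j))) \<otimes>\<^bsub>A\<^esub>
      finprod A (\<lambda>i. cochain1 u (merge_entries G 1 i x) [^]\<^bsub>A\<^esub> ((- 1) ^ i :: int)) {1..1} \<otimes>\<^bsub>A\<^esub>
      cochain1 u (\<lambda>j\<in>{1..1}. x j) [^]\<^bsub>A\<^esub> ((- 1)\<^sup>2 :: int) = coboundary u (x 1) (x 2)"
    using x12 by (simp add: coboundary_def uc mdl.int_pow_neg)
qed

text \<open>For \<open>n = 2\<close> the inner product has two factors, of exponents -1 and 1, and
  the last exponent is \<open>(-1)^3 = -1\<close>.\<close>

lemma hu_delta_cochain2:
  assumes F: "\<And>g h. \<lbrakk>g \<in> carrier G; h \<in> carrier G\<rbrakk> \<Longrightarrow> F g h \<in> carrier A"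
    and x: "x \<in> group_power G 3"
  shows "hu_delta G A 2 (cochain2 F) x =
    act A (x 1) (F (x 2) (x 3)) \<otimes>\<^bsub>A\<^esub> (inv\<^bsub>A\<^esub> F (x 1 \<otimes>\<^bsub>G\<^esub> x 2) (x 3) \<otimes>\<^bsub>A\<^esub> F (x 1) (x 2 \<otimes>\<^bsub>G\<^esub> x 3))
    \<otimes>\<^bsub>A\<^esub> inv\<^bsub>A\<^esub> F (x 1) (x 2)"
proof -
  have xc: "x 1 \<in> carrier G" "x 2 \<in> carrier G" "x 3 \<in> carrier G"
    using x by (auto simp: group_power_def)
  have "cochain2 F (\<lambda>j\<in>{1..2}. x (Suc j)) = F (x 2) (x 3)"
    "cochain2 F (\<lambda>j\<in>{1..2}. x j) = F (x 1) (x 2)"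
    "cochain2 F (merge_entries G 2 1 x) = F (x 1 \<otimes>\<^bsub>G\<^esub> x 2) (x 3)"
    "cochain2 F (merge_entries G 2 2 x) = F (x 1) (x 2 \<otimes>\<^bsub>G\<^esub> x 3)"
    using x xc by (auto simp: cochain2_def group_power_def merge_entries_def numeral_2_eq_2
        numeral_3_eq_3 le_Suc_eq)
  moreover have "{1..2} = {1, 2::nat}"
    by auto
  moreover have "group_power G (Suc 2) = group_power G 3"
    by simp
  ultimately show ?thesis
    using x xc F unfolding hu_delta_def by (simp add: mdl.int_pow_neg del: One_nat_def)
qed

section \<open>Cocycles, coboundaries and classes in degree two\<close>

text \<open>By commutativity the differential is the right side of the identity
  \<open>cocycle\<close> times the inverse of its left side.\<close>

lemma cochain2_in_hu_cocycles:
  assumes cont: "continuous_map (product_topology (\<lambda>_. topo G) {1..2::nat}) (topo A) (\<lambda>x. F (x 1) (x 2))"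
    and F: "\<And>g h. \<lbrakk>g \<in> carrier G; h \<in> carrier G\<rbrakk> \<Longrightarrow> F g h \<in> carrier A"
    and cocycle: "\<And>g h k. \<lbrakk>g \<in> carrier G; h \<in> carrier G; k \<in> carrier G\<rbrakk> \<Longrightarrow>
      F g h \<otimes>\<^bsub>A\<^esub> F (g \<otimes>\<^bsub>G\<^esub> h) k = act A g (F h k) \<otimes>\<^bsub>A\<^esub> F g (h \<otimes>\<^bsub>G\<^esub> k)"
  shows "cochain2 F \<in> carrier (hu_cocycles G A 2)"
proof -
  have "hu_delta G A 2 (cochain2 F) = \<one>\<^bsub>hu_cochains G A (Suc 2)\<^esub>"
  proof (rule extensionalityI[of _ "group_power G 3"])
    fix x
    assume x: "x \<in> group_power G 3"
    then have xc: "x 1 \<in> carrier G" "x 2 \<in> carrier G" "x 3 \<in> carrier G"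
      by (auto simp: group_power_def)
    have "hu_delta G A 2 (cochain2 F) x =
        (act A (x 1) (F (x 2) (x 3)) \<otimes>\<^bsub>A\<^esub> F (x 1) (x 2 \<otimes>\<^bsub>G\<^esub> x 3)) \<otimes>\<^bsub>A\<^esub>
        inv\<^bsub>A\<^esub> (F (x 1) (x 2) \<otimes>\<^bsub>A\<^esub> F (x 1 \<otimes>\<^bsub>G\<^esub> x 2) (x 3))"
      using x xc F by (simp add: hu_delta_cochain2 ab.inv_mult ab.m_ac del: One_nat_def)
    also have "\<dots> = \<one>\<^bsub>A\<^esub>"
      using xc F by (simp add: cocycle del: One_nat_def)
    finally show "hu_delta G A 2 (cochain2 F) x = \<one>\<^bsub>hu_cochains G A (Suc 2)\<^esub> x"
      using x by (simp add: hu_cochains_def)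
  qed (simp_all add: hu_delta_def hu_cochains_def)
  moreover have "cochain2 F \<in> carrier (hu_cochains G A 2)"
    unfolding cochain2_def using cont by (rule hu_cochainI)
  ultimately show ?thesis
    by (simp add: hu_cocycles_def kernel_def)
qed

lemma hu_coboundaries_2:
  "hu_coboundaries G A 2 = (\<lambda>u. cochain2 (coboundary u)) ` {u. continuous_map (topo G) (topo A) u}"
proof -
  have "hu_coboundaries G A 2 = hu_delta G A 1 ` carrier (hu_cochains G A 1)"
    by (simp add: hu_coboundaries_def numeral_2_eq_2)
  also have "carrier (hu_cochains G A 1) = cochain1 ` {u. continuous_map (topo G) (topo A) u}"
    using cochain1_in_hu_cochains by (blast elim: hu_cochain1_E)
  also have "hu_delta G A 1 ` cochain1 ` {u. continuous_map (topo G) (topo A) u} =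
      (\<lambda>u. cochain2 (coboundary u)) ` {u. continuous_map (topo G) (topo A) u}"
    unfolding image_image by (rule image_cong) (simp_all only: mem_Collect_eq hu_delta_cochain1)
  finally show ?thesis .
qed

lemma continuous_map_power_mult:
  assumes "continuous_map (topo G) X u"
  shows "continuous_map (product_topology (\<lambda>_. topo G) {1..2::nat}) X (\<lambda>x. u (x 1 \<otimes>\<^bsub>G\<^esub> x 2))"
proof -
  have "continuous_map (product_topology (\<lambda>_. topo G) {1..2}) (topo G) (\<lambda>x. x 1 \<otimes>\<^bsub>G\<^esub> x (2::nat))"
    by (intro grp.continuous_map_mult continuous_map_product_projection[of _ _ "\<lambda>_. topo G"]) auto
  from continuous_map_compose[OF this assms] show ?thesis
    by (simp add: o_def)
qed

lemma coboundary_in_hu_cochains: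
  assumes "continuous_map (topo G) (topo A) u"
  shows "cochain2 (coboundary u) \<in> carrier (hu_cochains G A 2)"
  unfolding cochain2_def coboundary_def
  by (intro hu_cochainI cont_intros continuous_map_power_coord continuous_map_power_mult assms
      continuous_map_product_projection[of _ _ "\<lambda>_. topo G"]) simp_all

text \<open>The differential is a homomorphism because commutativity lets the factors from
  \<open>u\<close> and \<open>u'\<close> be separated; its image is then a subgroup.\<close>

lemma subgroup_hu_coboundaries_2: "subgroup (hu_coboundaries G A 2) (hu_cochains G A 2)"
proof -
  have "hu_delta G A 1 \<in> hom (hu_cochains G A 1) (hu_cochains G A 2)"
  proof (rule homI)
    fix f f'
    assume "f \<in> carrier (hu_cochains G A 1)" "f' \<in> carrier (hu_cochains G A 1)"
    then obtain u u' where u: "continuous_map (topo G) (topo A) u" "f = cochain1 u"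
      and u': "continuous_map (topo G) (topo A) u'" "f' = cochain1 u'"
      by (elim hu_cochain1_E)
    show "hu_delta G A 1 f \<in> carrier (hu_cochains G A 2)"
      using u by (simp only: hu_delta_cochain1 coboundary_in_hu_cochains)
    have closed: "u g \<in> carrier A" "u' g \<in> carrier A" if "g \<in> carrier G" for g
      using mdl.continuous_map_closed[OF u(1)] mdl.continuous_map_closed[OF u'(1)] that
        grp.topspace_topo by simp_all
    have "f \<otimes>\<^bsub>hu_cochains G A 1\<^esub> f' = cochain1 (\<lambda>g. u g \<otimes>\<^bsub>A\<^esub> u' g)"
      unfolding u(2) u'(2) by (auto simp: hu_cochains_def cochain1_def intro!: restrict_ext)
    then have "hu_delta G A 1 (f \<otimes>\<^bsub>hu_cochains G A 1\<^esub> f') = cochain2 (coboundary (\<lambda>g. u g \<otimes>\<^bsub>A\<^esub> u' g))"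
      using u(1) u'(1) by (simp only: hu_delta_cochain1 mdl.continuous_map_mult)
    also have "\<dots> = cochain2 (\<lambda>g h. coboundary u g h \<otimes>\<^bsub>A\<^esub> coboundary u' g h)"
      by (simp add: cochain2_eq_iff coboundary_def closed act_mult ab.inv_mult ab.m_ac)
    also have "\<dots> = hu_delta G A 1 f \<otimes>\<^bsub>hu_cochains G A 2\<^esub> hu_delta G A 1 f'"
      unfolding u(2) u'(2) hu_delta_cochain1[OF u(1)] hu_delta_cochain1[OF u'(1)]
      by (auto simp: hu_cochains_def cochain2_def intro!: restrict_ext)
    finally show "hu_delta G A 1 (f \<otimes>\<^bsub>hu_cochains G A 1\<^esub> f') =
        hu_delta G A 1 f \<otimes>\<^bsub>hu_cochains G A 2\<^esub> hu_delta G A 1 f'" .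
  qed
  then interpret group_hom "hu_cochains G A 1" "hu_cochains G A 2" "hu_delta G A 1"
    using group_hu_cochains by (simp add: group_hom_def group_hom_axioms_def)
  show ?thesis
    using img_is_subgroup by (simp add: hu_coboundaries_def numeral_2_eq_2)
qed

text \<open>\<open>hu_cocycles\<close> changes only the carrier of the cochain group, and a coset
  depends only on the multiplication. Coset lemmas can thus be applied in the group of all
  cochains.\<close>

lemma hu_class_2_conv: "hu_class G A 2 f = hu_coboundaries G A 2 #>\<^bsub>hu_cochains G A 2\<^esub> f"
  by (simp add: hu_class_def hu_cocycles_def r_coset_def)

lemma hu_cocycle_is_cochain:
  "f \<in> carrier (hu_cocycles G A n) \<Longrightarrow> f \<in> carrier (hu_cochains G A n)"
  by (simp add: hu_cocycles_def kernel_def)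

text \<open>Multiplication by a coboundary stays within the coset, and a coset is determined by any
  of its members.\<close>

lemma hu_class_2_eqI:
  assumes F: "cochain2 F \<in> carrier (hu_cocycles G A 2)"
    and u: "continuous_map (topo G) (topo A) u"
    and eq: "\<And>g h. \<lbrakk>g \<in> carrier G; h \<in> carrier G\<rbrakk> \<Longrightarrow> F' g h = coboundary u g h \<otimes>\<^bsub>A\<^esub> F g h"
  shows "hu_class G A 2 (cochain2 F') = hu_class G A 2 (cochain2 F)"
proof -
  interpret Z: group "hu_cochains G A 2"
    by (rule group_hu_cochains)
  have "cochain2 F' = cochain2 (coboundary u) \<otimes>\<^bsub>hu_cochains G A 2\<^esub> cochain2 F"
    unfolding hu_cochains_def cochain2_def
    by (auto simp: group_power_2D eq simp del: One_nat_def intro!: restrict_ext)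
  then have "cochain2 F' \<in> hu_coboundaries G A 2 #>\<^bsub>hu_cochains G A 2\<^esub> cochain2 F"
    using u by (auto simp: r_coset_def hu_coboundaries_2)
  from Z.repr_independence[OF this hu_cocycle_is_cochain[OF F] subgroup_hu_coboundaries_2]
  show ?thesis
    by (simp add: hu_class_2_conv)
qed

text \<open>The basepoint of the quotient is the subgroup of coboundaries, and a coset equals the
  subgroup exactly when its representative lies in it.\<close>

lemma hu_class_2_trivial_iff:
  assumes F: "cochain2 F \<in> carrier (hu_cocycles G A 2)"
  shows "hu_class G A 2 (cochain2 F) = snd (H2 G A) \<longleftrightarrow>
    (\<exists>u. continuous_map (topo G) (topo A) u \<and>
      (\<forall>g\<in>carrier G. \<forall>h\<in>carrier G. F g h = coboundary u g h))"
proof -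
  interpret Z: group "hu_cochains G A 2"
    by (rule group_hu_cochains)
  have "snd (H2 G A) = hu_coboundaries G A 2"
    by (simp add: H2_def hu_cohomology_def FactGroup_def)
  then have "hu_class G A 2 (cochain2 F) = snd (H2 G A) \<longleftrightarrow> cochain2 F \<in> hu_coboundaries G A 2"
    using Z.coset_join1[OF _ hu_cocycle_is_cochain[OF F] subgroup_hu_coboundaries_2]
      Z.coset_join2[OF hu_cocycle_is_cochain[OF F] subgroup_hu_coboundaries_2]
    unfolding hu_class_2_conv by metis
  then show ?thesis
    by (auto simp: hu_coboundaries_2 cochain2_eq_iff)
qed

lemma hu_class_2_in_H2:
  "f \<in> carrier (hu_cocycles G A 2) \<Longrightarrow> hu_class G A 2 f \<in> fst (H2 G A)"
  by (auto simp: H2_def hu_cohomology_def FactGroup_def RCOSETS_def hu_class_def)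

end


section \<open>Central extensions\<close>

locale central_short_exact_modules = short_exact_modules G A B C \<iota> \<pi>
  for G :: "'g top_group" and A :: "('g, 'a) top_module" and B :: "('g, 'b) top_module"
    and C :: "('g, 'c) top_module" and \<iota> :: "'a \<Rightarrow> 'b" and \<pi> :: "'b \<Rightarrow> 'c" +
  fixes s :: "'c \<Rightarrow> 'b"
  assumes central: "\<iota> ` carrier A \<subseteq> group_center B"
    and continuous_section: "continuous_map (topo C) (topo B) s"
    and \<pi>_s: "\<And>c. c \<in> carrier C \<Longrightarrow> \<pi> (s c) = c"
begin

section \<open>Consequences of centrality\<close>

lemma \<iota>_commute: "\<lbrakk>a \<in> carrier A; b \<in> carrier B\<rbrakk> \<Longrightarrow> \<iota> a \<otimes>\<^bsub>B\<^esub> b = b \<otimes>\<^bsub>B\<^esub> \<iota> a"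
  using central by (auto simp: group_center_def)

text \<open>Brings central factors to the front of right-bracketed products. Its uses as a rewrite
  rule fix \<open>b\<close>, since otherwise two factors from \<open>A\<close> could be swapped
  forever.\<close>

lemma \<iota>_left_commute:
  "\<lbrakk>a \<in> carrier A; b \<in> carrier B; b' \<in> carrier B\<rbrakk> \<Longrightarrow>
    b \<otimes>\<^bsub>B\<^esub> (\<iota> a \<otimes>\<^bsub>B\<^esub> b') = \<iota> a \<otimes>\<^bsub>B\<^esub> (b \<otimes>\<^bsub>B\<^esub> b')"
  using \<iota>_commute[of a b] by (simp flip: B.mdl.m_assoc)

text \<open>The image of \<open>\<iota>\<close> is central, so its elements commute with each other,
  and injectivity transfers this to \<open>A\<close>.\<close>

sublocale Aab: abelian_topological_module G A
proof
  show "a \<otimes>\<^bsub>A\<^esub> b = b \<otimes>\<^bsub>A\<^esub> a" if "a \<in> carrier A" "b \<in> carrier A" for a b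
    using that \<iota>_commute[of a "\<iota> b"] by (intro \<iota>_eqD) simp_all
qed

lemma s_closed: "c \<in> carrier C \<Longrightarrow> s c \<in> carrier B"
  using B.mdl.continuous_map_closed[OF continuous_section] C.mdl.topspace_topo by simp

section \<open>The obstruction cocycle of a derivation\<close>

text \<open>The factor set of the lift \<open>s \<circ> \<alpha>\<close>: it measures how far this
  lift is from being a derivation.\<close>

definition obstruction :: "('g \<Rightarrow> 'c) \<Rightarrow> 'g \<Rightarrow> 'g \<Rightarrow> 'a"
  where "obstruction \<alpha> g h =
    \<iota>_inv (s (\<alpha> g) \<otimes>\<^bsub>B\<^esub> act B g (s (\<alpha> h)) \<otimes>\<^bsub>B\<^esub> inv\<^bsub>B\<^esub> s (\<alpha> (g \<otimes>\<^bsub>G\<^esub> h)))"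

lemma delta1_conv: "delta1 G A B \<iota> s X = (\<Union>\<alpha>\<in>X. hu_class G A 2 (Aab.cochain2 (obstruction \<alpha>)))"
  by (simp add: delta1_def Aab.cochain2_def obstruction_def)

context
  fixes \<alpha>
  assumes \<alpha>: "\<alpha> \<in> Der_c G C"
begin

lemma s_\<alpha>_closed: "g \<in> carrier G \<Longrightarrow> s (\<alpha> g) \<in> carrier B"
  by (intro s_closed C.Der_c_closed[OF \<alpha>])

lemma \<pi>_s_\<alpha>: "g \<in> carrier G \<Longrightarrow> \<pi> (s (\<alpha> g)) = \<alpha> g"
  by (intro \<pi>_s C.Der_c_closed[OF \<alpha>])

lemma continuous_s_\<alpha>: "continuous_map (topo G) (topo B) (\<lambda>g. s (\<alpha> g))"
  using continuous_map_compose[OF C.Der_c_continuous[OF \<alpha>] continuous_section] by (simp add: o_def)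

lemma obstruction_in_kernel:
  assumes "g \<in> carrier G" "h \<in> carrier G"
  shows "\<pi> (s (\<alpha> g) \<otimes>\<^bsub>B\<^esub> act B g (s (\<alpha> h)) \<otimes>\<^bsub>B\<^esub> inv\<^bsub>B\<^esub> s (\<alpha> (g \<otimes>\<^bsub>G\<^esub> h))) = \<one>\<^bsub>C\<^esub>"
  using assms C.Der_c_closed[OF \<alpha>]
  by (simp add: s_\<alpha>_closed p.equivariant \<pi>_s_\<alpha> C.Der_c_mult[OF \<alpha>, symmetric])

lemma obstruction_closed: "\<lbrakk>g \<in> carrier G; h \<in> carrier G\<rbrakk> \<Longrightarrow> obstruction \<alpha> g h \<in> carrier A"
  unfolding obstruction_def by (intro \<iota>_inv_closed obstruction_in_kernel) (simp_all add: s_\<alpha>_closed)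

text \<open>The form without inverses, on which the later calculations rest;
  \<open>obstruction_unique\<close> states that it determines the value.\<close>

lemma obstruction_eq:
  assumes "g \<in> carrier G" "h \<in> carrier G"
  shows "s (\<alpha> g) \<otimes>\<^bsub>B\<^esub> act B g (s (\<alpha> h)) = \<iota> (obstruction \<alpha> g h) \<otimes>\<^bsub>B\<^esub> s (\<alpha> (g \<otimes>\<^bsub>G\<^esub> h))"
proof -
  have "\<iota> (obstruction \<alpha> g h) =
      s (\<alpha> g) \<otimes>\<^bsub>B\<^esub> act B g (s (\<alpha> h)) \<otimes>\<^bsub>B\<^esub> inv\<^bsub>B\<^esub> s (\<alpha> (g \<otimes>\<^bsub>G\<^esub> h))"
    unfolding obstruction_def using assms
    by (intro \<iota>_\<iota>_inv obstruction_in_kernel) (simp_all add: s_\<alpha>_closed)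
  then show ?thesis
    using assms by (simp add: s_\<alpha>_closed B.mdl.m_assoc)
qed

lemma obstruction_unique:
  assumes "g \<in> carrier G" "h \<in> carrier G" "a \<in> carrier A"
    and "s (\<alpha> g) \<otimes>\<^bsub>B\<^esub> act B g (s (\<alpha> h)) = \<iota> a \<otimes>\<^bsub>B\<^esub> s (\<alpha> (g \<otimes>\<^bsub>G\<^esub> h))"
  shows "obstruction \<alpha> g h = a"
  using assms obstruction_eq[of g h]
  by (intro \<iota>_eqD) (simp_all add: s_\<alpha>_closed obstruction_closed)

text \<open>The triple product of \<open>s (\<alpha> g)\<close>, the translate by \<open>g\<close>
  of \<open>s (\<alpha> h)\<close> and the translate by \<open>gh\<close> of
  \<open>s (\<alpha> k)\<close> is reduced in two ways, joining first the left pair or first the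
  right pair. Cancelling \<open>s (\<alpha> (ghk))\<close> leaves the identity.\<close>

lemma obstruction_cocycle:
  assumes "g \<in> carrier G" "h \<in> carrier G" "k \<in> carrier G"
  shows "obstruction \<alpha> g h \<otimes>\<^bsub>A\<^esub> obstruction \<alpha> (g \<otimes>\<^bsub>G\<^esub> h) k =
    act A g (obstruction \<alpha> h k) \<otimes>\<^bsub>A\<^esub> obstruction \<alpha> g (h \<otimes>\<^bsub>G\<^esub> k)" (is "?l = ?r")
proof -
  let ?\<sigma> = "\<lambda>g. s (\<alpha> g)" and ?F = "obstruction \<alpha>"
  have "\<iota> ?l \<otimes>\<^bsub>B\<^esub> ?\<sigma> (g \<otimes>\<^bsub>G\<^esub> h \<otimes>\<^bsub>G\<^esub> k) =
      \<iota> (?F g h) \<otimes>\<^bsub>B\<^esub> (\<iota> (?F (g \<otimes>\<^bsub>G\<^esub> h) k) \<otimes>\<^bsub>B\<^esub> ?\<sigma> (g \<otimes>\<^bsub>G\<^esub> h \<otimes>\<^bsub>G\<^esub> k))"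
    using assms by (simp add: obstruction_closed s_\<alpha>_closed B.mdl.m_assoc)
  also have "\<dots> = \<iota> (?F g h) \<otimes>\<^bsub>B\<^esub> (?\<sigma> (g \<otimes>\<^bsub>G\<^esub> h) \<otimes>\<^bsub>B\<^esub> act B g (act B h (?\<sigma> k)))"
    using assms by (simp add: s_\<alpha>_closed B.act_act flip: obstruction_eq)
  also have "\<dots> = ?\<sigma> g \<otimes>\<^bsub>B\<^esub> act B g (?\<sigma> h) \<otimes>\<^bsub>B\<^esub> act B g (act B h (?\<sigma> k))"
    using assms obstruction_eq[of g h]
    by (simp add: s_\<alpha>_closed obstruction_closed flip: B.mdl.m_assoc)
  also have "\<dots> = ?\<sigma> g \<otimes>\<^bsub>B\<^esub> act B g (?\<sigma> h \<otimes>\<^bsub>B\<^esub> act B h (?\<sigma> k))"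
    using assms by (simp add: s_\<alpha>_closed B.act_mult B.mdl.m_assoc)
  \<comment> \<open>Centrality enters here: the translated factor from the right pair has to pass
    \<open>s (\<alpha> g)\<close>.\<close>
  also have "\<dots> = \<iota> (act A g (?F h k)) \<otimes>\<^bsub>B\<^esub> (?\<sigma> g \<otimes>\<^bsub>B\<^esub> act B g (?\<sigma> (h \<otimes>\<^bsub>G\<^esub> k)))"
    using assms by (simp add: obstruction_eq s_\<alpha>_closed obstruction_closed B.act_mult
        \<iota>_left_commute[of _ "s (\<alpha> g)"] flip: i.equivariant)
  also have "\<dots> = \<iota> ?r \<otimes>\<^bsub>B\<^esub> ?\<sigma> (g \<otimes>\<^bsub>G\<^esub> h \<otimes>\<^bsub>G\<^esub> k)"
    using assms by (simp add: obstruction_eq s_\<alpha>_closed obstruction_closed B.mdl.m_assoc A.grp.m_assoc)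
  finally show ?thesis
    using assms by (intro \<iota>_eqD) (simp_all add: s_\<alpha>_closed obstruction_closed)
qed

lemma obstruction_in_hu_cocycles: "Aab.cochain2 (obstruction \<alpha>) \<in> carrier (hu_cocycles G A 2)"
proof (rule Aab.cochain2_in_hu_cocycles)
  show "continuous_map (product_topology (\<lambda>_. topo G) {1..2::nat}) (topo A)
      (\<lambda>x. obstruction \<alpha> (x 1) (x 2))"
    unfolding obstruction_def
  proof (rule continuous_map_\<iota>_inv)
    show "continuous_map (product_topology (\<lambda>_. topo G) {1..2::nat}) (topo B)
        (\<lambda>x. s (\<alpha> (x 1)) \<otimes>\<^bsub>B\<^esub> act B (x 1) (s (\<alpha> (x 2))) \<otimes>\<^bsub>B\<^esub> inv\<^bsub>B\<^esub> s (\<alpha> (x 1 \<otimes>\<^bsub>G\<^esub> x 2)))"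
      by (intro B.cont_intros Aab.continuous_map_power_coord[OF continuous_s_\<alpha>]
          Aab.continuous_map_power_mult[OF continuous_s_\<alpha>]
          continuous_map_product_projection[of _ _ "\<lambda>_. topo G"]) simp_all
  qed (use obstruction_in_kernel Aab.group_power_2D in \<open>simp only: Aab.topspace_power\<close>)
qed (simp_all add: obstruction_closed obstruction_cocycle)

text \<open>Compares \<open>s \<circ> \<alpha>\<close> with any continuous lift
  \<open>\<tau>\<close> of \<open>\<alpha>\<close> having factor set \<open>F\<close> in
  \<open>A\<close>. The two lifts differ by a continuous \<open>u\<close> with values in
  \<open>A\<close>, which changes the factor set by its coboundary.\<close>

lemma obstruction_lift:
  assumes \<tau>: "continuous_map (topo G) (topo B) \<tau>" "\<And>g. g \<in> carrier G \<Longrightarrow> \<pi> (\<tau> g) = \<alpha> g"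
    and F: "\<And>g h. \<lbrakk>g \<in> carrier G; h \<in> carrier G\<rbrakk> \<Longrightarrow> F g h \<in> carrier A"
      "\<And>g h. \<lbrakk>g \<in> carrier G; h \<in> carrier G\<rbrakk> \<Longrightarrow>
        \<tau> g \<otimes>\<^bsub>B\<^esub> act B g (\<tau> h) = \<iota> (F g h) \<otimes>\<^bsub>B\<^esub> \<tau> (g \<otimes>\<^bsub>G\<^esub> h)"
  obtains u where "continuous_map (topo G) (topo A) u"
    "\<And>g h. \<lbrakk>g \<in> carrier G; h \<in> carrier G\<rbrakk> \<Longrightarrow>
      obstruction \<alpha> g h = Aab.coboundary u g h \<otimes>\<^bsub>A\<^esub> F g h"
proof
  define u where "u g = \<iota>_inv (s (\<alpha> g) \<otimes>\<^bsub>B\<^esub> inv\<^bsub>B\<^esub> \<tau> g)" for g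
  have \<tau>_closed: "\<tau> g \<in> carrier B" if "g \<in> carrier G" for g
    using B.mdl.continuous_map_closed[OF \<tau>(1)] that A.grp.topspace_topo by simp
  have ker: "\<pi> (s (\<alpha> g) \<otimes>\<^bsub>B\<^esub> inv\<^bsub>B\<^esub> \<tau> g) = \<one>\<^bsub>C\<^esub>" if "g \<in> carrier G" for g
    using that by (simp add: s_\<alpha>_closed \<tau>_closed \<tau>(2) \<pi>_s_\<alpha> C.Der_c_closed[OF \<alpha>])
  show "continuous_map (topo G) (topo A) u"
    unfolding u_def
    by (intro continuous_map_\<iota>_inv B.cont_intros continuous_s_\<alpha> \<tau>(1) ker) (simp add: A.grp.topspace_topo)
  have u: "u g \<in> carrier A" "\<iota> (u g) = s (\<alpha> g) \<otimes>\<^bsub>B\<^esub> inv\<^bsub>B\<^esub> \<tau> g" if "g \<in> carrier G" for g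
    unfolding u_def using that ker[OF that]
    by (simp_all add: s_\<alpha>_closed \<tau>_closed del: p.hm.hom_mult)
  have s_eq: "s (\<alpha> g) = \<iota> (u g) \<otimes>\<^bsub>B\<^esub> \<tau> g" if "g \<in> carrier G" for g
    using that by (simp add: u s_\<alpha>_closed \<tau>_closed B.mdl.m_assoc)
  show "obstruction \<alpha> g h = Aab.coboundary u g h \<otimes>\<^bsub>A\<^esub> F g h" if gh: "g \<in> carrier G" "h \<in> carrier G" for g h
  proof (rule obstruction_unique[OF gh])
    show "Aab.coboundary u g h \<otimes>\<^bsub>A\<^esub> F g h \<in> carrier A"
      using gh by (simp add: Aab.coboundary_def u F)
    have "s (\<alpha> g) \<otimes>\<^bsub>B\<^esub> act B g (s (\<alpha> h)) =
        \<iota> (u g) \<otimes>\<^bsub>B\<^esub> (\<iota> (act A g (u h)) \<otimes>\<^bsub>B\<^esub> (\<tau> g \<otimes>\<^bsub>B\<^esub> act B g (\<tau> h)))"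
      using gh by (simp add: s_eq u(1) \<tau>_closed B.act_mult B.mdl.m_assoc
          \<iota>_left_commute[of _ "\<tau> g"] flip: i.equivariant)
    also have "\<dots> = \<iota> (u g \<otimes>\<^bsub>A\<^esub> (act A g (u h) \<otimes>\<^bsub>A\<^esub> F g h)) \<otimes>\<^bsub>B\<^esub> \<tau> (g \<otimes>\<^bsub>G\<^esub> h)"
      using gh by (simp add: F u(1) \<tau>_closed B.mdl.m_assoc)
    \<comment> \<open>A factor \<open>u (gh)\<close> is split off against its inverse in the
      coboundary; it then turns \<open>\<tau> (gh)\<close> into
      \<open>s (\<alpha> (gh))\<close>.\<close>
    also have "u g \<otimes>\<^bsub>A\<^esub> (act A g (u h) \<otimes>\<^bsub>A\<^esub> F g h) =
        Aab.coboundary u g h \<otimes>\<^bsub>A\<^esub> F g h \<otimes>\<^bsub>A\<^esub> u (g \<otimes>\<^bsub>G\<^esub> h)"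
      using gh by (simp add: Aab.coboundary_def F u(1) Aab.ab.m_ac A.mdl.inv_mult_cancel)
    also have "\<iota> \<dots> \<otimes>\<^bsub>B\<^esub> \<tau> (g \<otimes>\<^bsub>G\<^esub> h) =
        \<iota> (Aab.coboundary u g h \<otimes>\<^bsub>A\<^esub> F g h) \<otimes>\<^bsub>B\<^esub> s (\<alpha> (g \<otimes>\<^bsub>G\<^esub> h))"
      using gh by (simp add: Aab.coboundary_def F u(1) s_eq \<tau>_closed B.mdl.m_assoc)
    finally show "s (\<alpha> g) \<otimes>\<^bsub>B\<^esub> act B g (s (\<alpha> h)) =
        \<iota> (Aab.coboundary u g h \<otimes>\<^bsub>A\<^esub> F g h) \<otimes>\<^bsub>B\<^esub> s (\<alpha> (g \<otimes>\<^bsub>G\<^esub> h))" .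
  qed
qed

end

section \<open>The connecting map in degree one and exactness at its source\<close>

text \<open>For cohomologous \<open>\<alpha>\<close> and \<open>\<alpha>'\<close>, a conjugate of
  \<open>s \<circ> \<alpha>\<close> is a continuous lift of \<open>\<alpha>'\<close> with the factor
  set of \<open>\<alpha>\<close>, so \<open>obstruction_lift\<close> makes the two obstructions
  differ by a coboundary.\<close>

lemma delta1_class:
  assumes "\<alpha> \<in> Der_c G C"
  shows "delta1 G A B \<iota> s (H1_class G C \<alpha>) = hu_class G A 2 (Aab.cochain2 (obstruction \<alpha>))"
proof -
  have "congruent (cohomologous G C) (\<lambda>\<alpha>. hu_class G A 2 (Aab.cochain2 (obstruction \<alpha>)))"
  proof (rule congruentI, elim C.cohomologousE)
    fix \<alpha> \<alpha>' c
    assume \<alpha>: "\<alpha> \<in> Der_c G C" and \<alpha>': "\<alpha>' \<in> Der_c G C" and c: "c \<in> carrier C"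
      and eq: "\<And>g. g \<in> carrier G \<Longrightarrow> \<alpha>' g = inv\<^bsub>C\<^esub> c \<otimes>\<^bsub>C\<^esub> \<alpha> g \<otimes>\<^bsub>C\<^esub> act C g c"
    \<comment> \<open>Conjugation by the lift \<open>s c\<close> of \<open>c\<close> covers the
      passage from \<open>\<alpha>\<close> to \<open>\<alpha>'\<close>. It preserves the factor set,
      whose values are central.\<close>
    define \<tau> where "\<tau> g = inv\<^bsub>B\<^esub> s c \<otimes>\<^bsub>B\<^esub> s (\<alpha> g) \<otimes>\<^bsub>B\<^esub> act B g (s c)" for g
    have closed: "s c \<in> carrier B" "s (\<alpha> g) \<in> carrier B" if "g \<in> carrier G" for g
      using c that by (simp_all add: s_closed s_\<alpha>_closed[OF \<alpha>])
    obtain u where "continuous_map (topo G) (topo A) u"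
      "\<And>g h. \<lbrakk>g \<in> carrier G; h \<in> carrier G\<rbrakk> \<Longrightarrow>
        obstruction \<alpha>' g h = Aab.coboundary u g h \<otimes>\<^bsub>A\<^esub> obstruction \<alpha> g h"
    proof (rule obstruction_lift[OF \<alpha>', of \<tau> "obstruction \<alpha>"])
      show "continuous_map (topo G) (topo B) \<tau>"
        unfolding \<tau>_def using c
        by (intro B.cont_intros continuous_s_\<alpha>[OF \<alpha>] continuous_map_id[unfolded id_def])
          (simp_all add: s_closed)
      show "\<pi> (\<tau> g) = \<alpha>' g" if "g \<in> carrier G" for g
        using that c by (simp add: \<tau>_def closed p.equivariant \<pi>_s eq \<pi>_s_\<alpha>[OF \<alpha>])
      show "obstruction \<alpha> g h \<in> carrier A" if "g \<in> carrier G" "h \<in> carrier G" for g h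
        by (rule obstruction_closed[OF \<alpha> that])
      show "\<tau> g \<otimes>\<^bsub>B\<^esub> act B g (\<tau> h) = \<iota> (obstruction \<alpha> g h) \<otimes>\<^bsub>B\<^esub> \<tau> (g \<otimes>\<^bsub>G\<^esub> h)"
        if gh: "g \<in> carrier G" "h \<in> carrier G" for g h
      proof -
        have "\<tau> g \<otimes>\<^bsub>B\<^esub> act B g (\<tau> h) =
            inv\<^bsub>B\<^esub> s c \<otimes>\<^bsub>B\<^esub> ((s (\<alpha> g) \<otimes>\<^bsub>B\<^esub> act B g (s (\<alpha> h))) \<otimes>\<^bsub>B\<^esub> act B g (act B h (s c)))"
          using gh by (simp add: \<tau>_def closed B.act_mult B.act_m_inv B.mdl.m_assoc B.mdl.inv_mult_cancel)
        also have "\<dots> = \<iota> (obstruction \<alpha> g h) \<otimes>\<^bsub>B\<^esub> \<tau> (g \<otimes>\<^bsub>G\<^esub> h)"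
          using gh by (simp add: obstruction_eq[OF \<alpha>] obstruction_closed[OF \<alpha>] \<tau>_def closed
              B.act_act B.mdl.m_assoc \<iota>_left_commute[of _ "inv\<^bsub>B\<^esub> s c"])
        finally show ?thesis .
      qed
    qed (rule that)
    then show "hu_class G A 2 (Aab.cochain2 (obstruction \<alpha>)) =
        hu_class G A 2 (Aab.cochain2 (obstruction \<alpha>'))"
      by (intro Aab.hu_class_2_eqI[symmetric] obstruction_in_hu_cocycles[OF \<alpha>])
  qed
  then show ?thesis
    unfolding delta1_conv H1_class_def by (rule UN_equiv_class[OF C.equiv_cohomologous _ assms])
qed

text \<open>The derivation \<open>\<beta>\<close> is itself a continuous lift of its image in
  \<open>C\<close>, with trivial factor set.\<close>

lemma delta1_H1_map:
  assumes \<beta>: "\<beta> \<in> Der_c G B"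
  shows "delta1 G A B \<iota> s (H1_map G C \<pi> (H1_class G B \<beta>)) = snd (H2 G A)"
proof -
  let ?\<alpha> = "\<lambda>g\<in>carrier G. \<pi> (\<beta> g)"
  have \<alpha>: "?\<alpha> \<in> Der_c G C"
    by (rule p.Der_c_comp[OF \<beta>])
  obtain u where u: "continuous_map (topo G) (topo A) u"
    "\<And>g h. \<lbrakk>g \<in> carrier G; h \<in> carrier G\<rbrakk> \<Longrightarrow>
      obstruction ?\<alpha> g h = Aab.coboundary u g h \<otimes>\<^bsub>A\<^esub> \<one>\<^bsub>A\<^esub>"
    by (rule obstruction_lift[OF \<alpha>, of \<beta> "\<lambda>_ _. \<one>\<^bsub>A\<^esub>"])
      (simp_all add: B.Der_c_continuous[OF \<beta>] B.Der_c_closed[OF \<beta>] B.Der_c_mult[OF \<beta>])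
  have "obstruction ?\<alpha> g h = Aab.coboundary u g h" if "g \<in> carrier G" "h \<in> carrier G" for g h
    using that A.mdl.continuous_map_closed[OF u(1)] A.grp.topspace_topo
    by (subst u(2)) (simp_all add: Aab.coboundary_def)
  then show ?thesis
    using u(1) Aab.hu_class_2_trivial_iff[OF obstruction_in_hu_cocycles[OF \<alpha>]]
    by (simp add: p.H1_map_class[OF \<beta>] delta1_class[OF \<alpha>]) blast
qed

lemma exact_at_H1_right: "exact_at (H1 G B) (H1_map G C \<pi>) (H1 G C) (delta1 G A B \<iota> s) (H2 G A)"
proof -
  have "delta1 G A B \<iota> s X \<in> fst (H2 G A)" if "X \<in> fst (H1 G C)" for X
    using that by (elim C.H1_E)
      (simp add: delta1_class Aab.hu_class_2_in_H2 obstruction_in_hu_cocycles)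
  \<comment> \<open>The basepoint is the image of the trivial class of \<open>B\<close>, so this is
    an instance of \<open>delta1_H1_map\<close>.\<close>
  moreover have "delta1 G A B \<iota> s (snd (H1 G C)) = snd (H2 G A)"
    using delta1_H1_map[OF B.trivial_in_Der_c] p.pointed_map_H1
    by (simp add: pointed_map_def) (simp add: H1_def)
  moreover have "delta1 G A B \<iota> s (H1_map G C \<pi> Y) = snd (H2 G A)" if "Y \<in> fst (H1 G B)" for Y
    using that delta1_H1_map by (elim B.H1_E) simp
  moreover have "X \<in> H1_map G C \<pi> ` fst (H1 G B)"
    if "X \<in> fst (H1 G C)" and "delta1 G A B \<iota> s X = snd (H2 G A)" for X
  proof -
    obtain \<alpha> where \<alpha>: "\<alpha> \<in> Der_c G C" and X: "X = H1_class G C \<alpha>"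
      using \<open>X \<in> fst (H1 G C)\<close> by (rule C.H1_E)
    obtain u where u: "continuous_map (topo G) (topo A) u"
      and eq: "\<And>g h. \<lbrakk>g \<in> carrier G; h \<in> carrier G\<rbrakk> \<Longrightarrow> obstruction \<alpha> g h = Aab.coboundary u g h"
      using \<open>delta1 G A B \<iota> s X = snd (H2 G A)\<close> Aab.hu_class_2_trivial_iff[OF obstruction_in_hu_cocycles[OF \<alpha>]]
      by (auto simp: X delta1_class[OF \<alpha>])
    have u_closed: "u g \<in> carrier A" if "g \<in> carrier G" for g
      using A.mdl.continuous_map_closed[OF u] that A.grp.topspace_topo by simp
    \<comment> \<open>Dividing \<open>s \<circ> \<alpha>\<close> by \<open>u\<close> removes the
      coboundary of \<open>u\<close> from the factor set, so a derivation remains.\<close>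
    let ?\<beta> = "\<lambda>g. \<iota> (inv\<^bsub>A\<^esub> u g) \<otimes>\<^bsub>B\<^esub> s (\<alpha> g)"
    have \<beta>: "restrict ?\<beta> (carrier G) \<in> Der_c G B"
    proof (rule B.Der_cI)
      show "continuous_map (topo G) (topo B) ?\<beta>"
        by (intro B.mdl.continuous_map_mult i.continuous_map_comp A.mdl.continuous_map_m_inv u
            continuous_s_\<alpha>[OF \<alpha>])
      fix g h
      assume gh: "g \<in> carrier G" "h \<in> carrier G"
      have "?\<beta> g \<otimes>\<^bsub>B\<^esub> act B g (?\<beta> h) =
          \<iota> (inv\<^bsub>A\<^esub> u g) \<otimes>\<^bsub>B\<^esub> (\<iota> (act A g (inv\<^bsub>A\<^esub> u h)) \<otimes>\<^bsub>B\<^esub> (s (\<alpha> g) \<otimes>\<^bsub>B\<^esub> act B g (s (\<alpha> h))))"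
        using gh by (simp add: s_\<alpha>_closed[OF \<alpha>] u_closed B.act_mult B.mdl.m_assoc
            \<iota>_left_commute[of _ "s (\<alpha> g)"] del: i.hm.hom_inv flip: i.equivariant)
      also have "\<dots> = \<iota> (inv\<^bsub>A\<^esub> u g \<otimes>\<^bsub>A\<^esub> (act A g (inv\<^bsub>A\<^esub> u h) \<otimes>\<^bsub>A\<^esub> Aab.coboundary u g h))
          \<otimes>\<^bsub>B\<^esub> s (\<alpha> (g \<otimes>\<^bsub>G\<^esub> h))"
        using gh obstruction_closed[OF \<alpha> gh]
        by (simp add: obstruction_eq[OF \<alpha>] eq s_\<alpha>_closed[OF \<alpha>] u_closed B.mdl.m_assoc)
      \<comment> \<open>The factors \<open>u g\<close> and \<open>act A g (u h)\<close> of the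
        coboundary cancel, leaving the inverse of \<open>u (gh)\<close>.\<close>
      also have "inv\<^bsub>A\<^esub> u g \<otimes>\<^bsub>A\<^esub> (act A g (inv\<^bsub>A\<^esub> u h) \<otimes>\<^bsub>A\<^esub> Aab.coboundary u g h) = inv\<^bsub>A\<^esub> u (g \<otimes>\<^bsub>G\<^esub> h)"
        using gh by (simp add: Aab.coboundary_def u_closed A.act_m_inv Aab.ab.m_ac A.mdl.inv_mult_cancel)
      finally show "?\<beta> (g \<otimes>\<^bsub>G\<^esub> h) = ?\<beta> g \<otimes>\<^bsub>B\<^esub> act B g (?\<beta> h)" ..
    qed
    \<comment> \<open>The correction by \<open>u\<close> is invisible in \<open>C\<close>, so
      \<open>\<alpha>\<close> is recovered exactly.\<close>
    have "(\<lambda>g\<in>carrier G. \<pi> (restrict ?\<beta> (carrier G) g)) = \<alpha>"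
      using p.Der_c_comp[OF \<beta>] \<alpha>
      by (rule C.Der_c_eqI)
        (simp add: s_\<alpha>_closed[OF \<alpha>] \<pi>_s_\<alpha>[OF \<alpha>] C.Der_c_closed[OF \<alpha>] u_closed del: i.hm.hom_inv)
    then have "H1_map G C \<pi> (H1_class G B (restrict ?\<beta> (carrier G))) = X"
      by (simp only: p.H1_map_class[OF \<beta>] X)
    then show ?thesis
      using B.H1_class_in_H1[OF \<beta>] by blast
  qed
  ultimately show ?thesis
    unfolding exact_at_def using p.pointed_map_H1 by (auto simp: pointed_map_def)
qed

end

section \<open>Assembly of the two exact sequences\<close>

theorem theorem4p1:
  fixes G :: "'g top_group"
    and A :: "('g, 'a) top_module"
    and B :: "('g, 'b) top_module"
    and C :: "('g, 'c) top_module"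
    and \<iota> :: "'a \<Rightarrow> 'b"
    and \<pi> :: "'b \<Rightarrow> 'c"
  assumes "topological_group G"
    and "short_exact_top_modules G A B C \<iota> \<pi>"
    and "embedding_map (topo A) (topo B) \<iota>"
  shows
    "(exact_at point (\<lambda>_. \<one>\<^bsub>A\<^esub>) (H0 G A) (H0_map G A \<iota>) (H0 G B) \<and>
      exact_at (H0 G A) (H0_map G A \<iota>) (H0 G B) (H0_map G B \<pi>) (H0 G C) \<and>
      exact_at (H0 G B) (H0_map G B \<pi>) (H0 G C) (delta0 G A B \<iota> \<pi>) (H1 G A) \<and>
      exact_at (H0 G C) (delta0 G A B \<iota> \<pi>) (H1 G A) (H1_map G B \<iota>) (H1 G B) \<and>
      exact_at (H1 G A) (H1_map G B \<iota>) (H1 G B) (H1_map G C \<pi>) (H1 G C))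
     \<and>
     (\<forall>s. \<iota> ` carrier A \<subseteq> group_center B \<and>
          continuous_map (topo C) (topo B) s \<and> (\<forall>c\<in>carrier C. \<pi> (s c) = c) \<longrightarrow>
      exact_at point (\<lambda>_. \<one>\<^bsub>A\<^esub>) (H0 G A) (H0_map G A \<iota>) (H0 G B) \<and>
      exact_at (H0 G A) (H0_map G A \<iota>) (H0 G B) (H0_map G B \<pi>) (H0 G C) \<and>
      exact_at (H0 G B) (H0_map G B \<pi>) (H0 G C) (delta0 G A B \<iota> \<pi>) (H1 G A) \<and>
      exact_at (H0 G C) (delta0 G A B \<iota> \<pi>) (H1 G A) (H1_map G B \<iota>) (H1 G B) \<and>
      exact_at (H1 G A) (H1_map G B \<iota>) (H1 G B) (H1_map G C \<pi>) (H1 G C) \<and>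
      exact_at (H1 G B) (H1_map G C \<pi>) (H1 G C) (delta1 G A B \<iota> s) (H2 G A))"
proof -
  have modules: "topological_module G A" "topological_module G B" "topological_module G C"
    and homs: "continuous_G_hom G A B \<iota>" "continuous_G_hom G B C \<pi>"
    and exact: "\<iota> \<in> mon A B" "\<pi> \<in> epi B C" "\<iota> ` carrier A = kernel B C \<pi>"
    using assms(2) by (simp_all add: short_exact_top_modules_def)
  have "topological_module_hom G A B \<iota>" "topological_module_hom G B C \<pi>"
    using modules homs by (simp_all add: topological_module_hom_def topological_module_hom_axioms_def)
  then interpret E: short_exact_modules G A B C \<iota> \<pi>
    using modules exact assms(3)
    by (simp add: short_exact_modules_def short_exact_modules_axioms_def mon_def epi_def)
  \<comment> \<open>Only this last position involves \<open>s\<close>, so the central locale is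
    interpreted separately for each section.\<close>
  have "exact_at (H1 G B) (H1_map G C \<pi>) (H1 G C) (delta1 G A B \<iota> s) (H2 G A)"
    if "\<iota> ` carrier A \<subseteq> group_center B" "continuous_map (topo C) (topo B) s"
      "\<forall>c\<in>carrier C. \<pi> (s c) = c" for s
  proof -
    interpret central_short_exact_modules G A B C \<iota> \<pi> s
      using that by unfold_locales auto
    show ?thesis
      by (rule exact_at_H1_right)
  qed
  then show ?thesis
    using E.exact_at_H0_left E.exact_at_H0_middle E.exact_at_H0_right E.exact_at_H1_left
      E.exact_at_H1_middle by blast
qed

end
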